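(* Let $\mathcal{L}$ be the class of cofibrations and $\mathcal{R}$ the class of fibrations in the category $\mathbf{2\text{-}Cob}$. Then $(\mathcal{L},\mathcal{R})$ is an orthogonal factorization system on $\mathbf{2\text{-}Cob}$.
   Context: Convention: $\mathbb{N}=\{0,1,2,\dots\}$. The category $\mathbf{2\text{-}Cob}$ (combinatorial definition). Objects are the finite sets $m=\{1,\dots,m\}$, $m\in\mathbb{N}$ (representing a disjoint union of $m$ circles). A cobordism $\phi: m\to n$ is given by data $\phi=\{m,n,C,l_m,l_n,g\}$: a finite set $C$, functions $l_m:m\to C$, $l_n:n\to C$, and a function $g:C\to\mathbb{N}$ (genus). Two cobordisms $\{m,n,C,l_m,l_n,g\}$ and $\{m,n,C',l_m',l_n',g'\}$ are identified when there is a bijection $\theta:C\to C'$ with $\theta l_m=l_m'$, $\theta l_n=l_n'$, $g'\theta=g$. The composite of $\phi=\{m,k,A,l_m,l_{k_1},g_1\}:m\to k$ and $\psi=\{k,n,B,l_{k_2},l_n,g_2\}:k\to n$ is $\psi\phi=\{m,n,C,\iota_Al_m,\iota_Bl_n,g\}$, where $C$, with maps $\iota_A:A\to C$ and $\iota_B:B\to C$, is the pushout of $A\xleftarrow{l_{k_1}}k\xrightarrow{l_{k_2}}B$ in sets, and for $x\in C$ $$g(x)=1+\sum_{a\in A,\ \iota_A(a)=x}(g_1(a)-1)+\sum_{b\in B,\ \iota_B(b)=x}(g_2(b)-1)+\#\{y\in k:\ \iota_Al_{k_1}(y)=x\}.$$ The identity of $n$ has $C=n$, both maps the identity, and $g=0$.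 A cobordism $\{m,n,C,l_m,l_n,g\}:m\to n$ is a cofibration if $l_n$ is injective and there is a function $u:n\to m$ with $l_n=l_m\circ u$. It is a fibration if $l_m$ is injective, $l_n$ is surjective, and $g\circ l_m=0$. An orthogonal factorization system on a category consists of two classes of morphisms $\mathcal{L},\mathcal{R}$ such that: (1) $\mathcal{L}$ and $\mathcal{R}$ are closed under composition and contain all isomorphisms; (2) every morphism $f$ factors as $f=r e$ with $e\in\mathcal{L}$, $r\in\mathcal{R}$; (3) for every commutative square $v e=r u$ with $e:X\to Y$ in $\mathcal{L}$, $r:X'\to Y'$ in $\mathcal{R}$, and $u:X\to X'$, $v:Y\to Y'$ arbitrary, there is a unique morphism $w:Y\to X'$ with $we=u$ and $rw=v$. *)

theory Defs
  imports Main "HOL-Library.FuncSet"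
begin

section \<open>Categories and orthogonal factorization systems\<close>

locale category =
  fixes obj :: "'o set"
    and hom :: "'o \<Rightarrow> 'o \<Rightarrow> 'm set"
    and comp :: "'m \<Rightarrow> 'm \<Rightarrow> 'm"  (infixr "\<cdot>" 70)
    and ident :: "'o \<Rightarrow> 'm"
  assumes hom_unique: "\<lbrakk>X \<in> obj; Y \<in> obj; X' \<in> obj; Y' \<in> obj; f \<in> hom X Y; f \<in> hom X' Y'\<rbrakk>
      \<Longrightarrow> X = X' \<and> Y = Y'"
    and ident_in_hom: "X \<in> obj \<Longrightarrow> ident X \<in> hom X X"
    and comp_in_hom: "\<lbrakk>X \<in> obj; Y \<in> obj; Z \<in> obj; f \<in> hom X Y; g \<in> hom Y Z\<rbrakk> \<Longrightarrow> g \<cdot> f \<in> hom X Z"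
    and comp_ident_right: "\<lbrakk>X \<in> obj; Y \<in> obj; f \<in> hom X Y\<rbrakk> \<Longrightarrow> f \<cdot> ident X = f"
    and comp_ident_left: "\<lbrakk>X \<in> obj; Y \<in> obj; f \<in> hom X Y\<rbrakk> \<Longrightarrow> ident Y \<cdot> f = f"
    and comp_assoc: "\<lbrakk>W \<in> obj; X \<in> obj; Y \<in> obj; Z \<in> obj; f \<in> hom W X; g \<in> hom X Y; h \<in> hom Y Z\<rbrakk>
      \<Longrightarrow> h \<cdot> (g \<cdot> f) = (h \<cdot> g) \<cdot> f"
begin

definition arrows :: "'m set" where
  "arrows = (\<Union>X\<in>obj. \<Union>Y\<in>obj. hom X Y)"

definition isomorphisms :: "'m set" where
  "isomorphisms = (\<Union>X\<in>obj. \<Union>Y\<in>obj.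
     {f \<in> hom X Y. \<exists>g\<in>hom Y X. g \<cdot> f = ident X \<and> f \<cdot> g = ident Y})"

end

locale orthogonal_factorization_system = category obj hom comp ident
  for obj :: "'o set"
    and hom :: "'o \<Rightarrow> 'o \<Rightarrow> 'm set"
    and comp :: "'m \<Rightarrow> 'm \<Rightarrow> 'm"  (infixr "\<cdot>" 70)
    and ident :: "'o \<Rightarrow> 'm" +
  fixes L R :: "'m set"
  assumes L_arrows: "L \<subseteq> arrows"
    and R_arrows: "R \<subseteq> arrows"
    and L_isos: "isomorphisms \<subseteq> L"
    and R_isos: "isomorphisms \<subseteq> R"
    and L_comp: "\<lbrakk>X \<in> obj; Y \<in> obj; Z \<in> obj; f \<in> hom X Y; g \<in> hom Y Z; f \<in> L; g \<in> L\<rbrakk> \<Longrightarrow> g \<cdot> f \<in> L"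
    and R_comp: "\<lbrakk>X \<in> obj; Y \<in> obj; Z \<in> obj; f \<in> hom X Y; g \<in> hom Y Z; f \<in> R; g \<in> R\<rbrakk> \<Longrightarrow> g \<cdot> f \<in> R"
    and factorization: "\<lbrakk>X \<in> obj; Y \<in> obj; f \<in> hom X Y\<rbrakk>
      \<Longrightarrow> \<exists>Z\<in>obj. \<exists>e\<in>hom X Z. \<exists>r\<in>hom Z Y. e \<in> L \<and> r \<in> R \<and> f = r \<cdot> e"
    and orthogonality: "\<lbrakk>X \<in> obj; Y \<in> obj; X' \<in> obj; Y' \<in> obj;
        e \<in> hom X Y; r \<in> hom X' Y'; u \<in> hom X X'; v \<in> hom Y Y'; e \<in> L; r \<in> R; v \<cdot> e = r \<cdot> u\<rbrakk>
      \<Longrightarrow> \<exists>!w. w \<in> hom Y X' \<and> w \<cdot> e = u \<and> r \<cdot> w = v"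


section \<open>Cobordism data\<close>

text \<open>The object \<open>m\<close> is the set \<open>{1..m}\<close>. The values of \<open>lin\<close>, \<open>lout\<close> and \<open>genus\<close> outside
  \<open>{1..src}\<close>, \<open>{1..tgt}\<close> and \<open>comps\<close> carry no information and are ignored throughout.\<close>

record 'c cob =
  src :: nat
  tgt :: nat
  comps :: "'c set"
  lin :: "nat \<Rightarrow> 'c"
  lout :: "nat \<Rightarrow> 'c"
  genus :: "'c \<Rightarrow> nat"

definition is_cob :: "'c cob \<Rightarrow> bool" where
  "is_cob \<phi> \<longleftrightarrow> finite (comps \<phi>) \<and> lin \<phi> \<in> {1..src \<phi>} \<rightarrow> comps \<phi> \<and> lout \<phi> \<in> {1..tgt \<phi>} \<rightarrow> comps \<phi>"

definition cob_equiv :: "'a cob \<Rightarrow> 'b cob \<Rightarrow> bool" where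
  "cob_equiv \<phi> \<phi>' \<longleftrightarrow> src \<phi> = src \<phi>' \<and> tgt \<phi> = tgt \<phi>' \<and>
     (\<exists>\<theta>. bij_betw \<theta> (comps \<phi>) (comps \<phi>') \<and>
          (\<forall>i\<in>{1..src \<phi>}. \<theta> (lin \<phi> i) = lin \<phi>' i) \<and>
          (\<forall>j\<in>{1..tgt \<phi>}. \<theta> (lout \<phi> j) = lout \<phi>' j) \<and>
          (\<forall>c\<in>comps \<phi>. genus \<phi>' (\<theta> c) = genus \<phi> c))"

definition is_cofibration :: "'c cob \<Rightarrow> bool" where
  "is_cofibration \<phi> \<longleftrightarrow> inj_on (lout \<phi>) {1..tgt \<phi>} \<and>
     (\<exists>u. u \<in> {1..tgt \<phi>} \<rightarrow> {1..src \<phi>} \<and> (\<forall>j\<in>{1..tgt \<phi>}. lout \<phi> j = lin \<phi> (u j)))"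

definition is_fibration :: "'c cob \<Rightarrow> bool" where
  "is_fibration \<phi> \<longleftrightarrow> inj_on (lin \<phi>) {1..src \<phi>} \<and> lout \<phi> ` {1..tgt \<phi>} = comps \<phi> \<and>
     (\<forall>i\<in>{1..src \<phi>}. genus \<phi> (lin \<phi> i) = 0)"

definition ident_cob :: "nat \<Rightarrow> nat cob" where
  "ident_cob n = \<lparr>src = n, tgt = n, comps = {1..n}, lin = id, lout = id, genus = (\<lambda>_. 0)\<rparr>"

text \<open>The pushout of \<open>A \<leftarrow> k \<rightarrow> B\<close> is the quotient of the disjoint union \<open>A <+> B\<close> by the
  equivalence relation generated by \<open>l\<^sub>k\<^sub>1(y) \<sim> l\<^sub>k\<^sub>2(y)\<close>; \<open>pushout_map\<close> comprises
  both coprojections.\<close>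

definition glue :: "'a cob \<Rightarrow> 'b cob \<Rightarrow> 'a + 'b \<Rightarrow> 'a + 'b \<Rightarrow> bool" where
  "glue \<phi> \<psi> p q \<longleftrightarrow> (\<exists>y\<in>{1..tgt \<phi>}. p = Inl (lout \<phi> y) \<and> q = Inr (lin \<psi> y))"

definition pushout_rel :: "'a cob \<Rightarrow> 'b cob \<Rightarrow> (('a + 'b) \<times> ('a + 'b)) set" where
  "pushout_rel \<phi> \<psi> = {(p, q). p \<in> comps \<phi> <+> comps \<psi> \<and> q \<in> comps \<phi> <+> comps \<psi> \<and> equivclp (glue \<phi> \<psi>) p q}"

definition pushout_map :: "'a cob \<Rightarrow> 'b cob \<Rightarrow> 'a + 'b \<Rightarrow> ('a + 'b) set" where
  "pushout_map \<phi> \<psi> p = pushout_rel \<phi> \<psi> `` {p}"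

text \<open>In \<open>comp_cob\<close> the integer given to \<^const>\<open>nat\<close> is never negative: the \<open>A\<close>- and \<open>B\<close>-components
  over \<open>x\<close> are the vertices, and the circles over \<open>x\<close> the edges, of a connected graph
  (lemma \<open>connected_card\<close> below).\<close>

definition comp_cob :: "'b cob \<Rightarrow> 'a cob \<Rightarrow> ('a + 'b) set cob" where
  "comp_cob \<psi> \<phi> = \<lparr>
     src = src \<phi>,
     tgt = tgt \<psi>,
     comps = (comps \<phi> <+> comps \<psi>) // pushout_rel \<phi> \<psi>,
     lin = (\<lambda>i. pushout_map \<phi> \<psi> (Inl (lin \<phi> i))),
     lout = (\<lambda>j. pushout_map \<phi> \<psi> (Inr (lout \<psi> j))),
     genus = (\<lambda>x. nat (1
        + (\<Sum>a\<in>{a\<in>comps \<phi>. pushout_map \<phi> \<psi> (Inl a) = x}. int (genus \<phi> a) - 1)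
        + (\<Sum>b\<in>{b\<in>comps \<psi>. pushout_map \<phi> \<psi> (Inr b) = x}. int (genus \<psi> b) - 1)
        + int (card {y\<in>{1..tgt \<phi>}. pushout_map \<phi> \<psi> (Inl (lout \<phi> y)) = x})))\<rparr>"


section \<open>The category 2-Cob\<close>

text \<open>A morphism is an equivalence class of cobordism data. Since every finite set is in bijection
  with a finite set of natural numbers, it suffices to take the representatives whose component set
  consists of natural numbers; \<open>cob_class\<close> assigns a class to data over any type.\<close>

type_synonym cobordism = "nat cob set"

definition cob_class :: "'c cob \<Rightarrow> cobordism" where
  "cob_class \<phi> = {\<chi>. is_cob \<chi> \<and> cob_equiv \<phi> \<chi>}"

definition Cob_hom :: "nat \<Rightarrow> nat \<Rightarrow> cobordism set" where
  "Cob_hom m n = {cob_class \<phi> | \<phi> :: nat cob. is_cob \<phi> \<and> src \<phi> = m \<and> tgt \<phi> = n}"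

definition Cob_comp :: "cobordism \<Rightarrow> cobordism \<Rightarrow> cobordism" where
  "Cob_comp \<Psi> \<Phi> = (\<Union>\<psi>\<in>\<Psi>. \<Union>\<phi>\<in>\<Phi>. cob_class (comp_cob \<psi> \<phi>))"

definition Cob_ident :: "nat \<Rightarrow> cobordism" where
  "Cob_ident n = cob_class (ident_cob n)"

definition cofibrations :: "cobordism set" where
  "cofibrations = {\<Phi>. \<exists>m n. \<Phi> \<in> Cob_hom m n \<and> (\<exists>\<phi>\<in>\<Phi>. is_cofibration \<phi>)}"

definition fibrations :: "cobordism set" where
  "fibrations = {\<Phi>. \<exists>m n. \<Phi> \<in> Cob_hom m n \<and> (\<exists>\<phi>\<in>\<Phi>. is_fibration \<phi>)}"

section \<open>Proof that 2-Cob is a category\<close>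

lemma connected_card:
  fixes s t :: "'e \<Rightarrow> 'v"
  assumes fin: "finite V" "finite E" and v: "v \<in> V"
    and R: "\<And>p q. R p q \<Longrightarrow> \<exists>e\<in>E. p = s e \<and> q = t e"
    and K: "K = {p \<in> V. equivclp R v p}"
    and EV: "\<And>e. e \<in> E \<Longrightarrow> s e \<in> V \<and> t e \<in> V \<and> R (s e) (t e)"
  shows "card K \<le> card {e\<in>E. s e \<in> K} + 1"
proof -
  let ?Q = "\<lambda>S. S \<subseteq> K \<and> v \<in> S \<and> card S \<le> card {e\<in>E. s e \<in> S \<and> t e \<in> S} + 1"
  have finK: "finite K" using fin K by simp
  define Q where "Q = ?Q"
  have "Q {v}" using v K by (auto simp: Q_def)
  moreover have "\<forall>S. Q S \<longrightarrow> card S < Suc (card K)" using finK by (simp add: card_mono Q_def less_Suc_eq_le)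
  ultimately obtain S where QS: "Q S" and maxQ: "\<forall>T. Q T \<longrightarrow> card T \<le> card S"
    using ex_has_greatest_nat[of Q "{v}" card "Suc (card K)"] by blast
  have S: "?Q S" and max: "\<And>T. ?Q T \<Longrightarrow> card T \<le> card S"
    using QS maxQ by (simp_all add: Q_def)
  have finS: "finite S" using S finK finite_subset by blast
  have closed: "z \<in> S" if y: "y \<in> S" and yz: "R y z \<or> R z y" for y z
  proof (rule ccontr)
    assume z: "z \<notin> S"
    obtain e where e: "e \<in> E" "(s e = y \<and> t e = z) \<or> (s e = z \<and> t e = y)" using yz R by metis
    have "equivclp R v y" using S y K by auto
    then have zK: "z \<in> K" using e EV[OF e(1)] yz K by (auto intro: equivclp_into_equivclp)
    have "insert e {e\<in>E. s e \<in> S \<and> t e \<in> S} \<subseteq> {e\<in>E. s e \<in> insert z S \<and> t e \<in> insert z S}"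
      using e y by auto
    then have "card (insert e {e\<in>E. s e \<in> S \<and> t e \<in> S}) \<le> card {e\<in>E. s e \<in> insert z S \<and> t e \<in> insert z S}"
      using fin by (intro card_mono) auto
    moreover have "card (insert e {e\<in>E. s e \<in> S \<and> t e \<in> S}) = Suc (card {e\<in>E. s e \<in> S \<and> t e \<in> S})"
      using fin e z by (subst card_insert_disjoint) auto
    ultimately have "?Q (insert z S)" using S zK finS z by auto
    then show False using max[of "insert z S"] finS z by auto
  qed
  have "K \<subseteq> S"
  proof
    fix p assume "p \<in> K"
    then have "equivclp R v p" using K by simp
    then show "p \<in> S" by (induction) (use S closed in auto)
  qed
  then have "S = K" using S by blast
  then have "card K \<le> card {e\<in>E. s e \<in> K \<and> t e \<in> K} + 1" using S by simp
  also have "\<dots> \<le> card {e\<in>E. s e \<in> K} + 1" using fin by (auto intro!: card_mono)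
  finally show ?thesis .
qed

text \<open>\<open>presents \<dots> f \<chi>\<close>: the components of \<open>\<chi>\<close> are, via \<open>f\<close>, the quotient of \<open>V\<close> by the equivalence
  relation generated by \<open>R\<close>, and the genus is computed by the composition formula from weights \<open>w\<close>
  (genus minus one) on \<open>V\<close> and from glued circles \<open>E\<close>. It covers binary and ternary composites, and
  determines \<open>\<chi>\<close> up to \<^const>\<open>cob_equiv\<close>.\<close>

locale presents =
  fixes m n :: nat
    and V :: "'v set" and R :: "'v \<Rightarrow> 'v \<Rightarrow> bool" and w :: "'v \<Rightarrow> int"
    and E :: "'e set" and s :: "'e \<Rightarrow> 'v"
    and i out :: "nat \<Rightarrow> 'v" and f :: "'v \<Rightarrow> 'c" and \<chi> :: "'c cob"
  assumes src: "src \<chi> = m" and tgt: "tgt \<chi> = n"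
    and finV: "finite V" and finE: "finite E"
    and comps: "comps \<chi> = f ` V"
    and ker: "\<And>p q. p \<in> V \<Longrightarrow> q \<in> V \<Longrightarrow> f p = f q \<longleftrightarrow> equivclp R p q"
    and iV: "\<And>k. Suc 0 \<le> k \<Longrightarrow> k \<le> m \<Longrightarrow> i k \<in> V"
    and lin: "\<And>k. Suc 0 \<le> k \<Longrightarrow> k \<le> m \<Longrightarrow> lin \<chi> k = f (i k)"
    and outV: "\<And>k. Suc 0 \<le> k \<Longrightarrow> k \<le> n \<Longrightarrow> out k \<in> V"
    and lout: "\<And>k. Suc 0 \<le> k \<Longrightarrow> k \<le> n \<Longrightarrow> lout \<chi> k = f (out k)"
    and sV: "\<And>e. e \<in> E \<Longrightarrow> s e \<in> V"
    and genus: "\<And>x. x \<in> f ` V \<Longrightarrow> int (genus \<chi> x) =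
      1 + (\<Sum>p\<in>{p\<in>V. f p = x}. w p) + int (card {e\<in>E. f (s e) = x})"

lemma presents_is_cob: "presents m n V R w E s i out f \<chi> \<Longrightarrow> is_cob \<chi>"
  by (auto simp: is_cob_def presents.src presents.tgt presents.comps presents.finV
      presents.lin presents.lout presents.iV presents.outV)

lemma presents_unique:
  assumes "presents m n V R w E s i out f \<chi>" "presents m n V R w E s i out f' \<chi>'"
  shows "cob_equiv \<chi> \<chi>'"
proof -
  interpret A: presents m n V R w E s i out f \<chi> by fact
  interpret B: presents m n V R w E s i out f' \<chi>' by fact
  define \<theta> where "\<theta> x = f' (inv_into V f x)" for x
  have ker: "f p = f q \<longleftrightarrow> f' p = f' q" if "p \<in> V" "q \<in> V" for p q
    using A.ker[OF that] B.ker[OF that] by simp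
  have \<theta>: "\<theta> (f p) = f' p" if "p \<in> V" for p
    unfolding \<theta>_def using that ker by (metis f_inv_into_f imageI inv_into_into)
  have "bij_betw \<theta> (comps \<chi>) (comps \<chi>')"
    unfolding A.comps B.comps
    by (rule bij_betw_imageI) (auto simp: inj_on_def \<theta> ker image_image)
  moreover have "genus \<chi>' (\<theta> c) = genus \<chi> c" if cV: "c \<in> comps \<chi>" for c
  proof -
    obtain p where p: "p \<in> V" "c = f p" using cV A.comps by auto
    have 1: "{q\<in>V. f q = f p} = {q\<in>V. f' q = f' p}" using p(1) ker by blast
    have 2: "{e\<in>E. f (s e) = f p} = {e\<in>E. f' (s e) = f' p}" using p(1) ker A.sV by blast
    have "int (genus \<chi>' (f' p)) = int (genus \<chi> (f p))"
      using A.genus[of "f p"] B.genus[of "f' p"] 1 2 p(1) by simp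
    then show ?thesis using p \<theta> by simp
  qed
  ultimately show ?thesis unfolding cob_equiv_def
    by (auto simp: A.src A.tgt B.src B.tgt \<theta> A.lin A.lout B.lin B.lout A.iV A.outV intro!: exI[of _ \<theta>])
qed

definition comp_via where
  "comp_via \<phi> \<psi> f \<chi> \<longleftrightarrow> presents (src \<phi>) (tgt \<psi>) (comps \<phi> <+> comps \<psi>) (glue \<phi> \<psi>)
     (case_sum (\<lambda>a. int (genus \<phi> a) - 1) (\<lambda>b. int (genus \<psi> b) - 1))
     {1..tgt \<phi>} (\<lambda>y. Inl (lout \<phi> y)) (\<lambda>i. Inl (lin \<phi> i)) (\<lambda>j. Inr (lout \<psi> j)) f \<chi>"

lemma sum_Plus_fibre:
  fixes w :: "'a + 'b \<Rightarrow> int"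
  assumes "finite A" "finite B"
  shows "(\<Sum>p\<in>{p\<in>A <+> B. P p}. w p) =
    (\<Sum>a\<in>{a\<in>A. P (Inl a)}. w (Inl a)) + (\<Sum>b\<in>{b\<in>B. P (Inr b)}. w (Inr b))"
proof -
  have "{p\<in>A <+> B. P p} = {a\<in>A. P (Inl a)} <+> {b\<in>B. P (Inr b)}" by auto
  then show ?thesis using assms by (simp add: sum.Plus)
qed

lemma cob_lin: "is_cob \<phi> \<Longrightarrow> Suc 0 \<le> i \<Longrightarrow> i \<le> src \<phi> \<Longrightarrow> lin \<phi> i \<in> comps \<phi>"
  and cob_lout: "is_cob \<phi> \<Longrightarrow> Suc 0 \<le> i \<Longrightarrow> i \<le> tgt \<phi> \<Longrightarrow> lout \<phi> i \<in> comps \<phi>"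
  and cob_finite: "is_cob \<phi> \<Longrightarrow> finite (comps \<phi>)"
  by (auto simp: is_cob_def)

lemma equiv_pushout_rel: "equiv (comps \<phi> <+> comps \<psi>) (pushout_rel \<phi> \<psi>)"
  unfolding pushout_rel_def
  by (rule equivI) (auto simp: refl_on_def sym_def trans_def intro: equivclp_sym equivclp_trans)

lemma pushout_map_eq_iff:
  assumes "p \<in> comps \<phi> <+> comps \<psi>" "q \<in> comps \<phi> <+> comps \<psi>"
  shows "pushout_map \<phi> \<psi> p = pushout_map \<phi> \<psi> q \<longleftrightarrow> equivclp (glue \<phi> \<psi>) p q"
  using eq_equiv_class_iff[OF equiv_pushout_rel assms] assms
  by (simp add: pushout_map_def pushout_rel_def)

lemma comp_cob_comp_via:
  assumes \<phi>: "is_cob \<phi>" and \<psi>: "is_cob \<psi>" and eq: "tgt \<phi> = src \<psi>"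
  shows "comp_via \<phi> \<psi> (pushout_map \<phi> \<psi>) (comp_cob \<psi> \<phi>)"
proof -
  let ?V = "comps \<phi> <+> comps \<psi>" and ?f = "pushout_map \<phi> \<psi>"
  let ?w = "case_sum (\<lambda>a. int (genus \<phi> a) - 1) (\<lambda>b. int (genus \<psi> b) - 1)"
  have fin: "finite ?V" using \<phi> \<psi> by (simp add: cob_finite)
  have "int (genus (comp_cob \<psi> \<phi>) x) =
     1 + (\<Sum>p\<in>{p\<in>?V. ?f p = x}. ?w p) + int (card {y\<in>{1..tgt \<phi>}. ?f (Inl (lout \<phi> y)) = x})"
    if x: "x \<in> ?f ` ?V" for x
  proof -
    obtain v where v: "v \<in> ?V" "x = ?f v" using x by auto
    define K where "K = {p\<in>?V. equivclp (glue \<phi> \<psi>) v p}"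
    have K': "K = {p\<in>?V. ?f p = x}" unfolding K_def using v pushout_map_eq_iff by (metis (lifting) equivclp_sym)
    have "card K \<le> card {y\<in>{1..tgt \<phi>}. Inl (lout \<phi> y) \<in> K} + 1"
      by (rule connected_card[OF fin _ v(1) _ K_def, where t = "\<lambda>y. Inr (lin \<psi> y)"])
        (use eq in \<open>auto simp: glue_def cob_lin[OF \<psi>] cob_lout[OF \<phi>]\<close>)
    also have "{y\<in>{1..tgt \<phi>}. Inl (lout \<phi> y) \<in> K} = {y\<in>{1..tgt \<phi>}. ?f (Inl (lout \<phi> y)) = x}"
      unfolding K' using cob_lout[OF \<phi>] by auto
    finally have 1: "int (card K) \<le> int (card {y\<in>{1..tgt \<phi>}. ?f (Inl (lout \<phi> y)) = x}) + 1" by linarith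
    have "(\<Sum>p\<in>K. -1) \<le> (\<Sum>p\<in>K. ?w p)"
      by (rule sum_mono) (auto split: sum.split)
    then have "0 \<le> 1 + (\<Sum>p\<in>K. ?w p) + int (card {y\<in>{1..tgt \<phi>}. ?f (Inl (lout \<phi> y)) = x})"
      using 1 by simp
    then show ?thesis unfolding K'
      using \<phi> \<psi> by (simp add: comp_cob_def sum_Plus_fibre cob_finite)
  qed
  note gen = this
  show ?thesis unfolding comp_via_def
  proof unfold_locales
    show "comps (comp_cob \<psi> \<phi>) = ?f ` ?V"
      by (auto simp: comp_cob_def quotient_def pushout_map_def)
    show "finite ?V" by (rule fin)
    show "?f p = ?f q \<longleftrightarrow> equivclp (glue \<phi> \<psi>) p q" if "p \<in> ?V" "q \<in> ?V" for p q
      by (rule pushout_map_eq_iff[OF that])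
    show "int (genus (comp_cob \<psi> \<phi>) x) =
       1 + (\<Sum>p\<in>{p\<in>?V. ?f p = x}. ?w p) + int (card {y\<in>{1..tgt \<phi>}. ?f (Inl (lout \<phi> y)) = x})"
      if "x \<in> ?f ` ?V" for x
      by (rule gen[OF that])
    show "src (comp_cob \<psi> \<phi>) = src \<phi>" "tgt (comp_cob \<psi> \<phi>) = tgt \<psi>"
      by (simp_all add: comp_cob_def)
    show "lin (comp_cob \<psi> \<phi>) k = ?f (Inl (lin \<phi> k))" "lout (comp_cob \<psi> \<phi>) k = ?f (Inr (lout \<psi> k))" for k
      by (simp_all add: comp_cob_def)
  qed (simp_all add: cob_lin[OF \<phi>] cob_lout[OF \<psi>] cob_lout[OF \<phi>] InlI InrI)
qed

lemma equivclp_map: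
  assumes "equivclp R p q" "\<And>x y. R x y \<Longrightarrow> equivclp S (h x) (h y)"
  shows "equivclp S (h p) (h q)"
  using assms(1)
proof induction
  case (step y z)
  have "equivclp S (h y) (h z)" using step(2) assms(2) by (metis equivclp_sym)
  with step.IH show ?case by (rule equivclp_trans)
qed simp

lemma equivclp_lift:
  assumes "equivclp S c c'" "p \<in> V" "q \<in> V" "h p = c" "h q = c'"
    and ker: "\<And>p q. p \<in> V \<Longrightarrow> q \<in> V \<Longrightarrow> h p = h q \<Longrightarrow> equivclp R p q"
    and S: "\<And>c c'. S c c' \<Longrightarrow> \<exists>p\<in>V. \<exists>q\<in>V. h p = c \<and> h q = c' \<and> equivclp R p q"
  shows "equivclp R p q"
  using assms(1,3,5)
proof (induction arbitrary: q)
  case base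
  then show ?case using ker assms by blast
next
  case (step y z)
  obtain a b where "a \<in> V" "b \<in> V" "h a = y" "h b = z" "equivclp R a b"
    using S step.hyps(2) by (meson equivclp_sym)
  then show ?case using step ker by (metis equivclp_trans)
qed

lemma comp_via_equiv:
  assumes c: "comp_via \<phi>' \<psi>' f \<chi>" and eqs: "cob_equiv \<phi> \<phi>'" "cob_equiv \<psi> \<psi>'"
    and cob: "is_cob \<phi>" "is_cob \<psi>" "tgt \<phi> = src \<psi>"
  shows "\<exists>f. comp_via \<phi> \<psi> f \<chi>"
proof -
  obtain \<alpha> where \<alpha>: "src \<phi> = src \<phi>'" "tgt \<phi> = tgt \<phi>'" "bij_betw \<alpha> (comps \<phi>) (comps \<phi>')"
    "\<And>i. i \<in> {1..src \<phi>} \<Longrightarrow> \<alpha> (lin \<phi> i) = lin \<phi>' i"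
    "\<And>i. i \<in> {1..tgt \<phi>} \<Longrightarrow> \<alpha> (lout \<phi> i) = lout \<phi>' i"
    "\<And>c. c \<in> comps \<phi> \<Longrightarrow> genus \<phi>' (\<alpha> c) = genus \<phi> c"
    using eqs(1) unfolding cob_equiv_def by blast
  obtain \<beta> where \<beta>: "src \<psi> = src \<psi>'" "tgt \<psi> = tgt \<psi>'" "bij_betw \<beta> (comps \<psi>) (comps \<psi>')"
    "\<And>i. i \<in> {1..src \<psi>} \<Longrightarrow> \<beta> (lin \<psi> i) = lin \<psi>' i"
    "\<And>i. i \<in> {1..tgt \<psi>} \<Longrightarrow> \<beta> (lout \<psi> i) = lout \<psi>' i"
    "\<And>c. c \<in> comps \<psi> \<Longrightarrow> genus \<psi>' (\<beta> c) = genus \<psi> c"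
    using eqs(2) unfolding cob_equiv_def by blast
  let ?V = "comps \<phi> <+> comps \<psi>" and ?V' = "comps \<phi>' <+> comps \<psi>'"
  define h where "h = map_sum \<alpha> \<beta>"
  have inj\<alpha>\<beta>: "inj_on \<alpha> (comps \<phi>)" "inj_on \<beta> (comps \<psi>)" "\<alpha> ` comps \<phi> = comps \<phi>'" "\<beta> ` comps \<psi> = comps \<psi>'"
    using \<alpha>(3) \<beta>(3) by (simp_all add: bij_betw_def)
  have inj: "inj_on h ?V"
    by (rule inj_onI) (auto simp: h_def elim!: PlusE dest: inj_onD[OF inj\<alpha>\<beta>(1)] inj_onD[OF inj\<alpha>\<beta>(2)])
  have img: "h ` ?V = ?V'"
    unfolding inj\<alpha>\<beta>(3,4)[symmetric] Plus_def image_Un image_image h_def by simp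
  have hV: "p \<in> ?V \<Longrightarrow> h p \<in> ?V'" for p using img by blast
  interpret C: presents "src \<phi>'" "tgt \<psi>'" ?V' "glue \<phi>' \<psi>'"
    "case_sum (\<lambda>a. int (genus \<phi>' a) - 1) (\<lambda>b. int (genus \<psi>' b) - 1)" "{1..tgt \<phi>'}"
    "\<lambda>y. Inl (lout \<phi>' y)" "\<lambda>i. Inl (lin \<phi>' i)" "\<lambda>j. Inr (lout \<psi>' j)" f \<chi>
    using c by (simp only: comp_via_def)
  have g1: "glue \<phi>' \<psi>' (h p) (h q)" if "glue \<phi> \<psi> p q" for p q
    using that \<alpha>(2,5) \<beta>(4) cob(3) unfolding glue_def h_def by auto
  have g2: "\<exists>p\<in>?V. \<exists>q\<in>?V. h p = c \<and> h q = c' \<and> equivclp (glue \<phi> \<psi>) p q" if g: "glue \<phi>' \<psi>' c c'" for c c'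
  proof -
    obtain y where y: "y \<in> {1..tgt \<phi>}" "c = Inl (lout \<phi>' y)" "c' = Inr (lin \<psi>' y)"
      using g \<alpha>(2) unfolding glue_def by auto
    then have "Inl (lout \<phi> y) \<in> ?V" "Inr (lin \<psi> y) \<in> ?V" "h (Inl (lout \<phi> y)) = c" "h (Inr (lin \<psi> y)) = c'"
      "glue \<phi> \<psi> (Inl (lout \<phi> y)) (Inr (lin \<psi> y))"
      using cob \<alpha>(5) \<beta>(4) by (auto simp: h_def glue_def cob_lin cob_lout)
    then show ?thesis by blast
  qed
  have ker: "f (h p) = f (h q) \<longleftrightarrow> equivclp (glue \<phi> \<psi>) p q" if "p \<in> ?V" "q \<in> ?V" for p q
  proof -
    have "equivclp (glue \<phi>' \<psi>') (h p) (h q) \<longleftrightarrow> equivclp (glue \<phi> \<psi>) p q"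
    proof
      assume "equivclp (glue \<phi>' \<psi>') (h p) (h q)"
      then show "equivclp (glue \<phi> \<psi>) p q"
        by (rule equivclp_lift[where h = h and V = ?V]) (use that inj g2 in \<open>auto dest: inj_onD\<close>)
    next
      assume "equivclp (glue \<phi> \<psi>) p q"
      then show "equivclp (glue \<phi>' \<psi>') (h p) (h q)"
        by (rule equivclp_map) (use g1 in auto)
    qed
    then show ?thesis using C.ker[OF hV[OF that(1)] hV[OF that(2)]] by simp
  qed
  let ?w = "case_sum (\<lambda>a. int (genus \<phi> a) - 1) (\<lambda>b. int (genus \<psi> b) - 1)"
  let ?w' = "case_sum (\<lambda>a. int (genus \<phi>' a) - 1) (\<lambda>b. int (genus \<psi>' b) - 1)"
  have gen: "int (genus \<chi> x) = 1 + (\<Sum>p\<in>{p\<in>?V. f (h p) = x}. ?w p) + int (card {y\<in>{1..tgt \<phi>}. f (h (Inl (lout \<phi> y))) = x})"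
    if "x \<in> (f \<circ> h) ` ?V" for x
  proof -
    have "(\<Sum>p\<in>{p\<in>?V'. f p = x}. ?w' p) = (\<Sum>p\<in>h ` {p\<in>?V. f (h p) = x}. ?w' p)"
      unfolding img[symmetric] by (rule sum.cong) auto
    also have "\<dots> = (\<Sum>p\<in>{p\<in>?V. f (h p) = x}. ?w' (h p))"
      by (subst sum.reindex) (use inj in \<open>auto simp: inj_on_def\<close>)
    also have "\<dots> = (\<Sum>p\<in>{p\<in>?V. f (h p) = x}. ?w p)"
      by (rule sum.cong) (auto simp: h_def \<alpha>(6) \<beta>(6))
    finally have 1: "(\<Sum>p\<in>{p\<in>?V'. f p = x}. ?w' p) = (\<Sum>p\<in>{p\<in>?V. f (h p) = x}. ?w p)" .
    have 2: "{y\<in>{1..tgt \<phi>'}. f (Inl (lout \<phi>' y)) = x} = {y\<in>{1..tgt \<phi>}. f (h (Inl (lout \<phi> y))) = x}"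
      by (rule Collect_cong, unfold \<alpha>(2)[symmetric], rule conj_cong) (simp_all add: h_def \<alpha>(5))
    have "x \<in> f ` ?V'" using that by (simp only: img[symmetric] image_comp)
    then show ?thesis using C.genus[of x] 1 2 by simp
  qed
  have "comp_via \<phi> \<psi> (f \<circ> h) \<chi>"
    unfolding comp_via_def
  proof unfold_locales
    show "src \<chi> = src \<phi>" "tgt \<chi> = tgt \<psi>" using C.src C.tgt \<alpha>(1) \<beta>(2) by auto
    show "finite ?V" using cob by (simp add: cob_finite)
    show "comps \<chi> = (f \<circ> h) ` ?V" using C.comps by (simp only: img[symmetric] image_comp)
    show "((f \<circ> h) p = (f \<circ> h) q) = equivclp (glue \<phi> \<psi>) p q" if "p \<in> ?V" "q \<in> ?V" for p q
      using ker[OF that] by simp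
    show "lin \<chi> k = (f \<circ> h) (Inl (lin \<phi> k))" if "Suc 0 \<le> k" "k \<le> src \<phi>" for k
      using C.lin[of k] \<alpha>(1,4) that by (simp add: h_def)
    show "lout \<chi> k = (f \<circ> h) (Inr (lout \<psi> k))" if "Suc 0 \<le> k" "k \<le> tgt \<psi>" for k
      using C.lout[of k] \<beta>(2,5) that by (simp add: h_def)
  qed (use gen in \<open>simp_all add: cob_lin[OF cob(1)] cob_lout[OF cob(2)] cob_lout[OF cob(1)] InlI InrI\<close>)
  then show ?thesis by blast
qed

lemma sum_fibres:
  fixes v :: "'z \<Rightarrow> int"
  assumes "finite Y" "finite W" "\<And>p. p \<in> Y \<Longrightarrow> g p \<in> W"
  shows "(\<Sum>c\<in>{c\<in>W. P c}. \<Sum>p\<in>{p\<in>Y. g p = c}. v p) = (\<Sum>p\<in>{p\<in>Y. P (g p)}. v p)"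
proof -
  have "(\<Sum>c\<in>{c\<in>W. P c}. \<Sum>p\<in>{p\<in>{p\<in>Y. P (g p)}. g p = c}. v p) = (\<Sum>p\<in>{p\<in>Y. P (g p)}. v p)"
    by (rule sum.group) (use assms in auto)
  moreover have "(\<Sum>c\<in>{c\<in>W. P c}. \<Sum>p\<in>{p\<in>{p\<in>Y. P (g p)}. g p = c}. v p) =
      (\<Sum>c\<in>{c\<in>W. P c}. \<Sum>p\<in>{p\<in>Y. g p = c}. v p)"
    by (rule sum.cong[OF refl], rule sum.cong) auto
  ultimately show ?thesis by (simp only:)
qed

lemma presents_refine:
  fixes h :: "'w \<Rightarrow> 'c" and \<pi> :: "'v \<Rightarrow> 'w" and s :: "'e \<Rightarrow> 'v"
  assumes X: "presents m n W S w' E' s' i' out' h \<chi>"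
    and V: "finite V" "\<pi> ` V = W"
    and ker: "\<And>p q. p \<in> V \<Longrightarrow> q \<in> V \<Longrightarrow> \<pi> p = \<pi> q \<Longrightarrow> equivclp R p q"
    and R: "\<And>p q. R p q \<Longrightarrow> equivclp S (\<pi> p) (\<pi> q)"
    and S: "\<And>c c'. S c c' \<Longrightarrow> \<exists>p\<in>V. \<exists>q\<in>V. \<pi> p = c \<and> \<pi> q = c' \<and> equivclp R p q"
    and i: "\<And>k. Suc 0 \<le> k \<Longrightarrow> k \<le> m \<Longrightarrow> i k \<in> V \<and> \<pi> (i k) = i' k"
    and out: "\<And>k. Suc 0 \<le> k \<Longrightarrow> k \<le> n \<Longrightarrow> out k \<in> V \<and> \<pi> (out k) = out' k"
    and E: "finite E" "E = Ka \<union> Kb" "Ka \<inter> Kb = {}" "\<And>e. e \<in> E \<Longrightarrow> s e \<in> V"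
    and \<sigma>: "bij_betw \<sigma> Kb E'" "\<And>e. e \<in> Kb \<Longrightarrow> \<pi> (s e) = s' (\<sigma> e)"
    and w: "\<And>c. c \<in> W \<Longrightarrow> w' c = (\<Sum>p\<in>{p\<in>V. \<pi> p = c}. w p) + int (card {e\<in>Ka. \<pi> (s e) = c})"
  shows "presents m n V R w E s i out (h \<circ> \<pi>) \<chi>"
proof -
  interpret X: presents m n W S w' E' s' i' out' h \<chi> by fact
  have \<pi>V: "p \<in> V \<Longrightarrow> \<pi> p \<in> W" for p using V by auto
  show ?thesis
  proof unfold_locales
    show "src \<chi> = m" "tgt \<chi> = n" "finite V" "finite E" by (fact X.src X.tgt V E)+
    show "comps \<chi> = (h \<circ> \<pi>) ` V" using X.comps V(2) by (simp only: image_comp[symmetric])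
    show "((h \<circ> \<pi>) p = (h \<circ> \<pi>) q) = equivclp R p q" if "p \<in> V" "q \<in> V" for p q
    proof -
      have "equivclp S (\<pi> p) (\<pi> q) \<longleftrightarrow> equivclp R p q"
        using equivclp_lift[where S = S and R = R and h = \<pi> and V = V, OF _ that refl refl ker S]
          equivclp_map[where S = S and R = R and h = \<pi>, OF _ R] by blast
      then show ?thesis using X.ker[OF \<pi>V \<pi>V] that by simp
    qed
    show "i k \<in> V" "lin \<chi> k = (h \<circ> \<pi>) (i k)" if "Suc 0 \<le> k" "k \<le> m" for k
      using that i X.lin by auto
    show "out k \<in> V" "lout \<chi> k = (h \<circ> \<pi>) (out k)" if "Suc 0 \<le> k" "k \<le> n" for k
      using that out X.lout by auto
    show "s e \<in> V" if "e \<in> E" for e by (rule E(4)[OF that])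
  next
    fix x assume "x \<in> (h \<circ> \<pi>) ` V"
    then have x: "x \<in> h ` W" using V(2) by (simp only: image_comp[symmetric])
    have fins: "finite Ka" "finite Kb" using E by auto
    have "(\<Sum>c\<in>{c\<in>W. h c = x}. w' c) =
       (\<Sum>c\<in>{c\<in>W. h c = x}. (\<Sum>p\<in>{p\<in>V. \<pi> p = c}. w p) + (\<Sum>e\<in>{e\<in>Ka. \<pi> (s e) = c}. 1))"
      by (rule sum.cong) (auto simp: w)
    also have "\<dots> = (\<Sum>p\<in>{p\<in>V. h (\<pi> p) = x}. w p) + (\<Sum>e\<in>{e\<in>Ka. h (\<pi> (s e)) = x}. 1)"
      unfolding sum.distrib
      using sum_fibres[where Y = V and W = W and g = \<pi> and P = "\<lambda>c. h c = x" and v = w]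
        sum_fibres[where Y = Ka and W = W and g = "\<lambda>e. \<pi> (s e)" and P = "\<lambda>c. h c = x" and v = "\<lambda>_. 1"]
        V(1) fins X.finV \<pi>V E by (simp del: sum_constant)
    finally have 1: "(\<Sum>c\<in>{c\<in>W. h c = x}. w' c) =
       (\<Sum>p\<in>{p\<in>V. h (\<pi> p) = x}. w p) + int (card {e\<in>Ka. h (\<pi> (s e)) = x})" by simp
    have "bij_betw \<sigma> {e\<in>Kb. h (\<pi> (s e)) = x} {e\<in>E'. h (s' e) = x}"
      using \<sigma> unfolding bij_betw_def inj_on_def by fastforce
    then have 2: "card {e\<in>E'. h (s' e) = x} = card {e\<in>Kb. h (\<pi> (s e)) = x}"
      by (simp add: bij_betw_same_card)
    have "{e\<in>E. h (\<pi> (s e)) = x} = {e\<in>Ka. h (\<pi> (s e)) = x} \<union> {e\<in>Kb. h (\<pi> (s e)) = x}"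
      using E(2) by auto
    then have 3: "card {e\<in>E. h (\<pi> (s e)) = x} = card {e\<in>Ka. h (\<pi> (s e)) = x} + card {e\<in>Kb. h (\<pi> (s e)) = x}"
      using fins E(3) by (simp add: card_Un_disjoint disjoint_iff)
    show "int (genus \<chi> x) = 1 + (\<Sum>p\<in>{p\<in>V. (h \<circ> \<pi>) p = x}. w p) + int (card {e\<in>E. (h \<circ> \<pi>) (s e) = x})"
      using X.genus[OF x] 1 2 3 by simp
  qed
qed

lemma presents_equiv:
  assumes "presents m n V R w E s i out f \<chi>" "cob_equiv \<chi> \<chi>'"
  shows "\<exists>f'. presents m n V R w E s i out f' \<chi>'"
proof -
  interpret A: presents m n V R w E s i out f \<chi> by fact
  obtain \<theta> where \<theta>: "src \<chi> = src \<chi>'" "tgt \<chi> = tgt \<chi>'" "bij_betw \<theta> (comps \<chi>) (comps \<chi>')"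
    "\<And>i. i \<in> {1..src \<chi>} \<Longrightarrow> \<theta> (lin \<chi> i) = lin \<chi>' i"
    "\<And>i. i \<in> {1..tgt \<chi>} \<Longrightarrow> \<theta> (lout \<chi> i) = lout \<chi>' i"
    "\<And>c. c \<in> comps \<chi> \<Longrightarrow> genus \<chi>' (\<theta> c) = genus \<chi> c"
    using assms(2) unfolding cob_equiv_def by blast
  have inj: "\<theta> (f p) = \<theta> (f q) \<longleftrightarrow> f p = f q" if "p \<in> V" "q \<in> V" for p q
    using \<theta>(3) that unfolding bij_betw_def A.comps by (auto dest: inj_onD)
  have "presents m n V R w E s i out (\<theta> \<circ> f) \<chi>'"
  proof unfold_locales
    show "src \<chi>' = m" "tgt \<chi>' = n" using \<theta> A.src A.tgt by auto
    show "comps \<chi>' = (\<theta> \<circ> f) ` V" using \<theta>(3) A.comps by (auto simp: bij_betw_def)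
    show "lin \<chi>' k = (\<theta> \<circ> f) (i k)" if "Suc 0 \<le> k" "k \<le> m" for k
      using \<theta>(4)[of k] A.lin[OF that] that A.src by simp
    show "lout \<chi>' k = (\<theta> \<circ> f) (out k)" if "Suc 0 \<le> k" "k \<le> n" for k
      using \<theta>(5)[of k] A.lout[OF that] that A.tgt by simp
    show "((\<theta> \<circ> f) p = (\<theta> \<circ> f) q) = equivclp R p q" if "p \<in> V" "q \<in> V" for p q
      using inj[OF that] A.ker[OF that] by simp
    fix x assume "x \<in> (\<theta> \<circ> f) ` V"
    then obtain p where p: "p \<in> V" "x = \<theta> (f p)" by auto
    have 1: "{q\<in>V. \<theta> (f q) = \<theta> (f p)} = {q\<in>V. f q = f p}" using p inj by blast
    have 2: "{e\<in>E. \<theta> (f (s e)) = \<theta> (f p)} = {e\<in>E. f (s e) = f p}" using p inj A.sV by blast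
    show "int (genus \<chi>' x) = 1 + (\<Sum>q\<in>{q\<in>V. (\<theta> \<circ> f) q = x}. w q) + int (card {e\<in>E. (\<theta> \<circ> f) (s e) = x})"
      using A.genus[of "f p"] \<theta>(6)[of "f p"] p A.comps by (simp add: 1 2)
  qed (simp_all add: A.finV A.finE A.iV A.outV A.sV)
  then show ?thesis by blast
qed

lemma cob_equiv_refl: "cob_equiv \<phi> \<phi>"
  unfolding cob_equiv_def by (auto intro!: exI[of _ id])

lemma cob_equiv_trans:
  assumes "cob_equiv \<phi> \<psi>" "cob_equiv \<psi> \<chi>" shows "cob_equiv \<phi> \<chi>"
proof -
  obtain \<alpha> where \<alpha>: "bij_betw \<alpha> (comps \<phi>) (comps \<psi>)" "\<forall>i\<in>{1..src \<phi>}. \<alpha> (lin \<phi> i) = lin \<psi> i"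
    "\<forall>i\<in>{1..tgt \<phi>}. \<alpha> (lout \<phi> i) = lout \<psi> i" "\<forall>c\<in>comps \<phi>. genus \<psi> (\<alpha> c) = genus \<phi> c"
    using assms(1) unfolding cob_equiv_def by blast
  obtain \<beta> where \<beta>: "bij_betw \<beta> (comps \<psi>) (comps \<chi>)" "\<forall>i\<in>{1..src \<psi>}. \<beta> (lin \<psi> i) = lin \<chi> i"
    "\<forall>i\<in>{1..tgt \<psi>}. \<beta> (lout \<psi> i) = lout \<chi> i" "\<forall>c\<in>comps \<psi>. genus \<chi> (\<beta> c) = genus \<psi> c"
    using assms(2) unfolding cob_equiv_def by blast
  have "bij_betw (\<beta> \<circ> \<alpha>) (comps \<phi>) (comps \<chi>)" using \<alpha>(1) \<beta>(1) by (rule bij_betw_trans)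
  moreover have "src \<phi> = src \<psi>" "src \<psi> = src \<chi>" "tgt \<phi> = tgt \<psi>" "tgt \<psi> = tgt \<chi>"
    using assms unfolding cob_equiv_def by auto
  ultimately show ?thesis unfolding cob_equiv_def using \<alpha> \<beta>
    by (auto intro!: exI[of _ "\<beta> \<circ> \<alpha>"] dest: bij_betwE)
qed

lemma cob_equiv_sym:
  assumes "cob_equiv \<phi> \<psi>" and \<phi>: "is_cob \<phi>" shows "cob_equiv \<psi> \<phi>"
proof -
  obtain \<alpha> where \<alpha>: "bij_betw \<alpha> (comps \<phi>) (comps \<psi>)" "\<forall>i\<in>{1..src \<phi>}. \<alpha> (lin \<phi> i) = lin \<psi> i"
    "\<forall>i\<in>{1..tgt \<phi>}. \<alpha> (lout \<phi> i) = lout \<psi> i" "\<forall>c\<in>comps \<phi>. genus \<psi> (\<alpha> c) = genus \<phi> c"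
    and st: "src \<phi> = src \<psi>" "tgt \<phi> = tgt \<psi>"
    using assms unfolding cob_equiv_def by blast
  let ?\<beta> = "inv_into (comps \<phi>) \<alpha>"
  have inv: "?\<beta> (\<alpha> c) = c" if "c \<in> comps \<phi>" for c
    using bij_betw_inv_into_left[OF \<alpha>(1) that] .
  show ?thesis unfolding cob_equiv_def
  proof (intro conjI exI[of _ ?\<beta>] ballI)
    show "bij_betw ?\<beta> (comps \<psi>) (comps \<phi>)" by (rule bij_betw_inv_into[OF \<alpha>(1)])
    show "src \<psi> = src \<phi>" "tgt \<psi> = tgt \<phi>" using st by auto
    show "?\<beta> (lin \<psi> i) = lin \<phi> i" if "i \<in> {1..src \<psi>}" for i
      using \<alpha>(2) inv cob_lin[OF \<phi>, of i] that st by force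
    show "?\<beta> (lout \<psi> i) = lout \<phi> i" if "i \<in> {1..tgt \<psi>}" for i
      using \<alpha>(3) inv cob_lout[OF \<phi>, of i] that st by force
    show "genus \<phi> (?\<beta> c) = genus \<psi> c" if c: "c \<in> comps \<psi>" for c
    proof -
      obtain b where "b \<in> comps \<phi>" "c = \<alpha> b" using \<alpha>(1) c by (auto simp: bij_betw_def)
      then show ?thesis using inv \<alpha>(4) by simp
    qed
  qed
qed

lemma ex_nat_cob:
  assumes "is_cob \<phi>" shows "\<exists>\<chi> :: nat cob. is_cob \<chi> \<and> cob_equiv \<phi> \<chi>"
proof -
  obtain \<alpha> where \<alpha>: "bij_betw \<alpha> (comps \<phi>) {0..<card (comps \<phi>)}"
    using ex_bij_betw_finite_nat[OF cob_finite[OF assms]] by blast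
  define \<chi> where "\<chi> = \<lparr>src = src \<phi>, tgt = tgt \<phi>, comps = {0..<card (comps \<phi>)},
    lin = \<alpha> \<circ> lin \<phi>, lout = \<alpha> \<circ> lout \<phi>, genus = genus \<phi> \<circ> inv_into (comps \<phi>) \<alpha>\<rparr>"
  have 1: "\<alpha> c < card (comps \<phi>)" if "c \<in> comps \<phi>" for c
    using bij_betwE[OF \<alpha>] that by auto
  have "cob_equiv \<phi> \<chi>" unfolding cob_equiv_def \<chi>_def
    using \<alpha> bij_betw_inv_into_left[OF \<alpha>] by (auto intro!: exI[of _ \<alpha>])
  moreover have "is_cob \<chi>"
    using assms by (auto simp: is_cob_def \<chi>_def Pi_iff intro!: 1)
  ultimately show ?thesis by blast
qed

lemma cob_class_eqI:
  assumes "is_cob \<phi>" "cob_equiv \<phi> \<chi>"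
  shows "cob_class \<phi> = cob_class \<chi>"
proof -
  have "cob_equiv \<phi> \<xi> \<longleftrightarrow> cob_equiv \<chi> \<xi>" for \<xi> :: "nat cob"
    using cob_equiv_trans[OF assms(2)] cob_equiv_trans[OF cob_equiv_sym[OF assms(2,1)]] by metis
  then show ?thesis by (simp add: cob_class_def)
qed

lemma cob_class_self: "is_cob \<phi> \<Longrightarrow> \<phi> \<in> cob_class \<phi>"
  by (simp add: cob_class_def cob_equiv_refl)

lemma cob_class_src_tgt: "\<phi> \<in> cob_class \<chi> \<Longrightarrow> src \<phi> = src \<chi> \<and> tgt \<phi> = tgt \<chi>"
  by (auto simp: cob_class_def cob_equiv_def)

lemma Cob_hom_class:
  assumes "is_cob \<phi>" shows "cob_class \<phi> \<in> Cob_hom (src \<phi>) (tgt \<phi>)"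
proof -
  obtain \<chi> :: "nat cob" where \<chi>: "is_cob \<chi>" "cob_equiv \<phi> \<chi>" using ex_nat_cob[OF assms] by blast
  then show ?thesis unfolding Cob_hom_def using cob_class_eqI[OF assms \<chi>(2)]
    by (auto simp: cob_equiv_def intro!: exI[of _ \<chi>])
qed

lemma comp_via_cob:
  assumes "comp_via \<phi> \<psi> f \<chi>"
  shows "is_cob \<chi>" "src \<chi> = src \<phi>" "tgt \<chi> = tgt \<psi>"
  using assms unfolding comp_via_def
  by (fact presents_is_cob presents.src presents.tgt)+

lemma Cob_comp_class:
  assumes c: "comp_via \<phi> \<psi> f \<chi>" and cob: "is_cob \<phi>" "is_cob \<psi>" "tgt \<phi> = src \<psi>"
  shows "Cob_comp (cob_class \<psi>) (cob_class \<phi>) = cob_class \<chi>"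
proof -
  have "cob_class (comp_cob \<psi>' \<phi>') = cob_class \<chi>" if "\<psi>' \<in> cob_class \<psi>" "\<phi>' \<in> cob_class \<phi>" for \<phi>' \<psi>'
  proof -
    have *: "is_cob \<psi>'" "is_cob \<phi>'" "cob_equiv \<psi> \<psi>'" "cob_equiv \<phi> \<phi>'" "tgt \<phi>' = src \<psi>'"
      using that cob(3) by (auto simp: cob_class_def cob_equiv_def)
    obtain f' where "comp_via \<phi> \<psi> f' (comp_cob \<psi>' \<phi>')"
      using comp_via_equiv[OF comp_cob_comp_via[OF *(2,1,5)] *(4,3) cob] by blast
    then have "cob_equiv \<chi> (comp_cob \<psi>' \<phi>')"
      using c unfolding comp_via_def by (metis presents_unique)
    then show ?thesis using cob_class_eqI[OF comp_via_cob(1)[OF c]] by blast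
  qed
  moreover have "cob_class \<phi> \<noteq> {}" "cob_class \<psi> \<noteq> {}"
    using ex_nat_cob cob unfolding cob_class_def by blast+
  ultimately show ?thesis unfolding Cob_comp_def by auto
qed

lemma comp_via_ident_right:
  assumes \<phi>: "is_cob \<phi>"
  shows "comp_via (ident_cob (src \<phi>)) \<phi> (case_sum (lin \<phi>) id) \<phi>"
proof -
  let ?I = "ident_cob (src \<phi>)" and ?f = "case_sum (lin \<phi>) id"
  have [simp]: "comps ?I = {1..src \<phi>}" "src ?I = src \<phi>" "tgt ?I = src \<phi>" "lin ?I = id" "lout ?I = id" "genus ?I = (\<lambda>_. 0)"
    by (simp_all add: ident_cob_def)
  let ?V = "comps ?I <+> comps \<phi>"
  have pr: "equivclp (glue ?I \<phi>) p (Inr (?f p))" if "p \<in> ?V" for p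
    using that by (cases p) (auto simp: glue_def intro!: r_into_equivclp)
  show ?thesis unfolding comp_via_def
  proof unfold_locales
    show "finite ?V" using \<phi> by (simp add: cob_finite)
    show "comps \<phi> = ?f ` ?V" using cob_lin[OF \<phi>] by (force simp: image_iff)
    show "(?f p = ?f q) = equivclp (glue ?I \<phi>) p q" if "p \<in> ?V" "q \<in> ?V" for p q
    proof
      assume "?f p = ?f q"
      then show "equivclp (glue ?I \<phi>) p q" using pr that by (metis equivclp_sym equivclp_trans)
    next
      assume "equivclp (glue ?I \<phi>) p q"
      then show "?f p = ?f q" by induction (auto simp: glue_def)
    qed
    fix x assume "x \<in> ?f ` ?V"
    then have x: "x \<in> comps \<phi>" using cob_lin[OF \<phi>] by auto
    then have "{b\<in>comps \<phi>. b = x} = {x}" by auto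
    then show "int (genus \<phi> x) = 1 + (\<Sum>p\<in>{p\<in>?V. ?f p = x}.
        case_sum (\<lambda>a. int (genus ?I a) - 1) (\<lambda>b. int (genus \<phi> b) - 1) p)
        + int (card {y\<in>{1..tgt ?I}. ?f (Inl (lout ?I y)) = x})"
      using \<phi> by (simp add: sum_Plus_fibre cob_finite)
  qed (auto simp: cob_lin[OF \<phi>] cob_lout[OF \<phi>])
qed

lemma comp_via_ident_left:
  assumes \<phi>: "is_cob \<phi>"
  shows "comp_via \<phi> (ident_cob (tgt \<phi>)) (case_sum id (lout \<phi>)) \<phi>"
proof -
  let ?I = "ident_cob (tgt \<phi>)" and ?f = "case_sum id (lout \<phi>)"
  have [simp]: "comps ?I = {1..tgt \<phi>}" "src ?I = tgt \<phi>" "tgt ?I = tgt \<phi>" "lin ?I = id" "lout ?I = id" "genus ?I = (\<lambda>_. 0)"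
    by (simp_all add: ident_cob_def)
  let ?V = "comps \<phi> <+> comps ?I"
  have pr: "equivclp (glue \<phi> ?I) (Inl (?f p)) p" if "p \<in> ?V" for p
    using that by (cases p) (auto simp: glue_def intro!: r_into_equivclp)
  show ?thesis unfolding comp_via_def
  proof unfold_locales
    show "finite ?V" using \<phi> by (simp add: cob_finite)
    show "comps \<phi> = ?f ` ?V" using cob_lout[OF \<phi>] by (force simp: image_iff)
    show "(?f p = ?f q) = equivclp (glue \<phi> ?I) p q" if "p \<in> ?V" "q \<in> ?V" for p q
    proof
      assume "?f p = ?f q"
      then show "equivclp (glue \<phi> ?I) p q" using pr that by (metis equivclp_sym equivclp_trans)
    next
      assume "equivclp (glue \<phi> ?I) p q"
      then show "?f p = ?f q" by induction (auto simp: glue_def)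
    qed
    fix x assume "x \<in> ?f ` ?V"
    then have x: "x \<in> comps \<phi>" using cob_lout[OF \<phi>] by auto
    then have "{b\<in>comps \<phi>. b = x} = {x}" by auto
    then show "int (genus \<phi> x) = 1 + (\<Sum>p\<in>{p\<in>?V. ?f p = x}.
        case_sum (\<lambda>a. int (genus \<phi> a) - 1) (\<lambda>b. int (genus ?I b) - 1) p)
        + int (card {y\<in>{1..tgt \<phi>}. ?f (Inl (lout \<phi> y)) = x})"
      using \<phi> by (simp add: sum_Plus_fibre cob_finite)
  qed (auto simp: cob_lin[OF \<phi>] cob_lout[OF \<phi>])
qed

definition glue3 :: "'a cob \<Rightarrow> 'b cob \<Rightarrow> 'd cob \<Rightarrow> 'a + ('b + 'd) \<Rightarrow> 'a + ('b + 'd) \<Rightarrow> bool" where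
  "glue3 \<phi> \<psi> \<tau> p q \<longleftrightarrow>
     (\<exists>y\<in>{1..tgt \<phi>}. p = Inl (lout \<phi> y) \<and> q = Inr (Inl (lin \<psi> y))) \<or>
     (\<exists>z\<in>{1..tgt \<psi>}. p = Inr (Inl (lout \<psi> z)) \<and> q = Inr (Inr (lin \<tau> z)))"

definition comp3_via where
  "comp3_via \<phi> \<psi> \<tau> f \<chi> \<longleftrightarrow> presents (src \<phi>) (tgt \<tau>) (comps \<phi> <+> (comps \<psi> <+> comps \<tau>)) (glue3 \<phi> \<psi> \<tau>)
     (case_sum (\<lambda>a. int (genus \<phi> a) - 1) (case_sum (\<lambda>b. int (genus \<psi> b) - 1) (\<lambda>d. int (genus \<tau> d) - 1)))
     ({1..tgt \<phi>} <+> {1..tgt \<psi>}) (case_sum (\<lambda>y. Inl (lout \<phi> y)) (\<lambda>z. Inr (Inl (lout \<psi> z))))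
     (\<lambda>i. Inl (lin \<phi> i)) (\<lambda>j. Inr (Inr (lout \<tau> j))) f \<chi>"

lemma comp3_via_left:
  fixes \<phi> :: "'a cob" and \<psi> :: "'b cob" and \<tau> :: "'d cob" and \<chi> :: "'c cob"
  assumes X1: "comp_via \<phi> \<psi> f \<chi>" and X: "comp_via \<chi> \<tau> h \<xi>"
    and cob: "is_cob \<phi>" "is_cob \<psi>" "is_cob \<tau>" "tgt \<phi> = src \<psi>" "tgt \<psi> = src \<tau>"
  shows "\<exists>F. comp3_via \<phi> \<psi> \<tau> F \<xi>"
proof -
  interpret C: presents "src \<phi>" "tgt \<psi>" "comps \<phi> <+> comps \<psi>" "glue \<phi> \<psi>"
    "case_sum (\<lambda>a. int (genus \<phi> a) - 1) (\<lambda>b. int (genus \<psi> b) - 1)" "{1..tgt \<phi>}"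
    "\<lambda>y. Inl (lout \<phi> y)" "\<lambda>i. Inl (lin \<phi> i)" "\<lambda>j. Inr (lout \<psi> j)" f \<chi>
    using X1 by (simp only: comp_via_def)
  let ?V = "comps \<phi> <+> (comps \<psi> <+> comps \<tau>)" and ?U = "comps \<phi> <+> comps \<psi>"
  let ?W = "comps \<chi> <+> comps \<tau>"
  let ?w = "case_sum (\<lambda>a. int (genus \<phi> a) - 1) (case_sum (\<lambda>b. int (genus \<psi> b) - 1) (\<lambda>d. int (genus \<tau> d) - 1))"
  let ?wU = "case_sum (\<lambda>a. int (genus \<phi> a) - 1) (\<lambda>b. int (genus \<psi> b) - 1)"
  let ?s = "case_sum (\<lambda>y. Inl (lout \<phi> y)) (\<lambda>z. Inr (Inl (lout \<psi> z)))"
  define \<pi> :: "'a + ('b + 'd) \<Rightarrow> 'c + 'd" where "\<pi> = case_sum (\<lambda>a. Inl (f (Inl a))) (case_sum (\<lambda>b. Inl (f (Inr b))) Inr)"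
  define j :: "'a + 'b \<Rightarrow> 'a + ('b + 'd)" where "j = case_sum Inl (\<lambda>b. Inr (Inl b))"
  have [simp]: "src \<chi> = src \<phi>" "tgt \<chi> = tgt \<psi>" by (fact C.src C.tgt)+
  have \<pi>j: "\<pi> (j p) = Inl (f p)" for p unfolding \<pi>_def j_def by (cases p) auto
  have injj: "inj j" unfolding j_def by (auto simp: inj_on_def split: sum.splits)
  have jV: "j p \<in> ?V" if "p \<in> ?U" for p using that unfolding j_def by auto
  have gj: "equivclp (glue3 \<phi> \<psi> \<tau>) (j p) (j q)" if "equivclp (glue \<phi> \<psi>) p q" for p q
    using that by (rule equivclp_map) (auto simp: glue_def glue3_def j_def intro!: r_into_equivclp)
  have V: "(\<exists>p'\<in>?U. p = j p') \<or> (\<exists>d\<in>comps \<tau>. p = Inr (Inr d))" if "p \<in> ?V" for p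
    using that unfolding j_def by (auto 0 4 intro: bexI[of _ "Inl _"] bexI[of _ "Inr _"])
  have \<pi>d: "\<pi> (Inr (Inr d)) = Inr d" for d by (simp add: \<pi>_def)
  have "presents (src \<phi>) (tgt \<tau>) ?V (glue3 \<phi> \<psi> \<tau>) ?w ({1..tgt \<phi>} <+> {1..tgt \<psi>}) ?s
     (\<lambda>i. Inl (lin \<phi> i)) (\<lambda>j. Inr (Inr (lout \<tau> j))) (h \<circ> \<pi>) \<xi>"
  proof (rule presents_refine[where Ka = "Inl ` {1..tgt \<phi>}" and Kb = "Inr ` {1..tgt \<psi>}" and \<sigma> = projr])
    show "presents (src \<phi>) (tgt \<tau>) ?W (glue \<chi> \<tau>)
     (case_sum (\<lambda>a. int (genus \<chi> a) - 1) (\<lambda>b. int (genus \<tau> b) - 1))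
     {1..tgt \<psi>} (\<lambda>y. Inl (lout \<chi> y)) (\<lambda>i. Inl (lin \<chi> i)) (\<lambda>j. Inr (lout \<tau> j)) h \<xi>"
      using X by (simp add: comp_via_def)
    show "finite ?V" using cob by (simp add: cob_finite)
    show "\<pi> ` ?V = ?W"
    proof -
      have "\<pi> ` ?V = Inl ` f ` ?U \<union> Inr ` comps \<tau>"
        by (auto simp: Plus_def image_Un image_image \<pi>_def)
      then show ?thesis by (simp add: C.comps Plus_def)
    qed
    show "equivclp (glue3 \<phi> \<psi> \<tau>) p q" if "p \<in> ?V" "q \<in> ?V" and e: "\<pi> p = \<pi> q" for p q
      using V[OF that(1)] V[OF that(2)]
    proof (elim disjE bexE)
      fix p' q' assume "p' \<in> ?U" "p = j p'" "q' \<in> ?U" "q = j q'"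
      then show ?thesis using e C.ker[of p' q'] gj by (simp add: \<pi>j)
    qed (use e in \<open>auto simp: \<pi>j \<pi>d\<close>)
    show "equivclp (glue \<chi> \<tau>) (\<pi> p) (\<pi> q)" if "glue3 \<phi> \<psi> \<tau> p q" for p q
      using that unfolding glue3_def
    proof (elim disjE bexE conjE)
      fix y assume y: "y \<in> {1..tgt \<phi>}" "p = Inl (lout \<phi> y)" "q = Inr (Inl (lin \<psi> y))"
      have "glue \<phi> \<psi> (Inl (lout \<phi> y)) (Inr (lin \<psi> y))" using y by (auto simp: glue_def)
      from r_into_equivclp[of "glue \<phi> \<psi>", OF this] have "f (Inl (lout \<phi> y)) = f (Inr (lin \<psi> y))"
        using C.ker[of "Inl (lout \<phi> y)" "Inr (lin \<psi> y)"] cob y by (auto simp: cob_lin cob_lout InlI InrI)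
      then show ?thesis using y by (simp add: \<pi>_def)
    next
      fix z assume z: "z \<in> {1..tgt \<psi>}" "p = Inr (Inl (lout \<psi> z))" "q = Inr (Inr (lin \<tau> z))"
      then have "lout \<chi> z = f (Inr (lout \<psi> z))" by (simp add: C.lout)
      then have "glue \<chi> \<tau> (\<pi> p) (\<pi> q)" using z by (auto simp: glue_def \<pi>_def intro!: bexI[of _ z])
      then show ?thesis by (rule r_into_equivclp)
    qed
    show "\<exists>p\<in>?V. \<exists>q\<in>?V. \<pi> p = c \<and> \<pi> q = c' \<and> equivclp (glue3 \<phi> \<psi> \<tau>) p q" if g: "glue \<chi> \<tau> c c'" for c c'
    proof -
      obtain z where z: "z \<in> {1..tgt \<psi>}" "c = Inl (lout \<chi> z)" "c' = Inr (lin \<tau> z)"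
        using g unfolding glue_def by auto
      show ?thesis
      proof (intro bexI conjI)
        show "equivclp (glue3 \<phi> \<psi> \<tau>) (Inr (Inl (lout \<psi> z))) (Inr (Inr (lin \<tau> z)))"
          by (rule r_into_equivclp) (use z in \<open>auto simp: glue3_def\<close>)
      qed (use z cob in \<open>auto simp: \<pi>_def C.lout cob_lin cob_lout\<close>)
    qed
    show "Inl (lin \<phi> k) \<in> ?V \<and> \<pi> (Inl (lin \<phi> k)) = Inl (lin \<chi> k)" if "Suc 0 \<le> k" "k \<le> src \<phi>" for k
      using that cob by (simp add: \<pi>_def C.lin cob_lin InlI)
    show "Inr (Inr (lout \<tau> k)) \<in> ?V \<and> \<pi> (Inr (Inr (lout \<tau> k))) = Inr (lout \<tau> k)" if "Suc 0 \<le> k" "k \<le> tgt \<tau>" for k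
      using that cob by (simp add: \<pi>_def cob_lout InrI)
    show "finite ({1..tgt \<phi>} <+> {1..tgt \<psi>})" by simp
    show "{1..tgt \<phi>} <+> {1..tgt \<psi>} = Inl ` {1..tgt \<phi>} \<union> Inr ` {1..tgt \<psi>}" by (simp add: Plus_def)
    show "Inl ` {1..tgt \<phi>} \<inter> Inr ` {1..tgt \<psi>} = {}" by auto
    show "?s e \<in> ?V" if "e \<in> {1..tgt \<phi>} <+> {1..tgt \<psi>}" for e
      using that cob by (auto simp: cob_lout)
    show "bij_betw projr (Inr ` {1..tgt \<psi>}) {1..tgt \<psi>}"
      by (rule bij_betw_imageI) (auto simp: inj_on_def image_image)
    show "\<pi> (?s e) = Inl (lout \<chi> (projr e))" if "e \<in> Inr ` {1..tgt \<psi>}" for e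
      using that by (auto simp: \<pi>_def C.lout)
    fix c assume c: "c \<in> ?W"
    show "case_sum (\<lambda>a. int (genus \<chi> a) - 1) (\<lambda>b. int (genus \<tau> b) - 1) c =
       (\<Sum>p\<in>{p\<in>?V. \<pi> p = c}. ?w p) + int (card {e\<in>Inl ` {1..tgt \<phi>}. \<pi> (?s e) = c})"
    proof (cases c)
      case (Inl x)
      then have x: "x \<in> f ` ?U" using c C.comps by auto
      have "{p\<in>?V. \<pi> p = c} = j ` {p\<in>?U. f p = x}" (is "?l = ?r")
      proof
        show "?l \<subseteq> ?r" using V Inl by (force simp: \<pi>j \<pi>d)
        show "?r \<subseteq> ?l" using jV Inl by (auto simp: \<pi>j simp del: Plus_def)
      qed
      then have "(\<Sum>p\<in>{p\<in>?V. \<pi> p = c}. ?w p) = (\<Sum>p\<in>{p\<in>?U. f p = x}. ?w (j p))"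
        using injj by (simp add: sum.reindex inj_on_def)
      also have "\<dots> = (\<Sum>p\<in>{p\<in>?U. f p = x}. ?wU p)"
        by (rule sum.cong) (auto simp: j_def)
      finally have 1: "(\<Sum>p\<in>{p\<in>?V. \<pi> p = c}. ?w p) = (\<Sum>p\<in>{p\<in>?U. f p = x}. ?wU p)" .
      have "{e\<in>Inl ` {1..tgt \<phi>}. \<pi> (?s e) = c} = Inl ` {y\<in>{1..tgt \<phi>}. f (Inl (lout \<phi> y)) = x}"
        using Inl by (auto simp: \<pi>_def)
      then have 2: "card {e\<in>Inl ` {1..tgt \<phi>}. \<pi> (?s e) = c} = card {y\<in>{1..tgt \<phi>}. f (Inl (lout \<phi> y)) = x}"
        by (simp add: card_image)
      show ?thesis using C.genus[OF x] 1 2 Inl by simp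
    next
      case (Inr d)
      have 1: "{p\<in>?V. \<pi> p = c} = {Inr (Inr d)}" using c Inr by (auto simp: \<pi>_def)
      have 2: "{e\<in>Inl ` {1..tgt \<phi>}. \<pi> (?s e) = c} = {}" using Inr by (auto simp: \<pi>_def)
      show ?thesis unfolding 1 2 using Inr by simp
    qed
  qed
  then show ?thesis unfolding comp3_via_def by blast
qed

lemma comp3_via_right:
  fixes \<phi> :: "'a cob" and \<psi> :: "'b cob" and \<tau> :: "'d cob" and \<chi> :: "'c cob"
  assumes X1: "comp_via \<psi> \<tau> f \<chi>" and X: "comp_via \<phi> \<chi> h \<xi>"
    and cob: "is_cob \<phi>" "is_cob \<psi>" "is_cob \<tau>" "tgt \<phi> = src \<psi>" "tgt \<psi> = src \<tau>"
  shows "\<exists>F. comp3_via \<phi> \<psi> \<tau> F \<xi>"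
proof -
  interpret C: presents "src \<psi>" "tgt \<tau>" "comps \<psi> <+> comps \<tau>" "glue \<psi> \<tau>"
    "case_sum (\<lambda>a. int (genus \<psi> a) - 1) (\<lambda>b. int (genus \<tau> b) - 1)" "{1..tgt \<psi>}"
    "\<lambda>y. Inl (lout \<psi> y)" "\<lambda>i. Inl (lin \<psi> i)" "\<lambda>j. Inr (lout \<tau> j)" f \<chi>
    using X1 by (simp only: comp_via_def)
  let ?U = "comps \<psi> <+> comps \<tau>"
  let ?V = "comps \<phi> <+> ?U"
  let ?W = "comps \<phi> <+> comps \<chi>"
  let ?wU = "case_sum (\<lambda>b. int (genus \<psi> b) - 1) (\<lambda>d. int (genus \<tau> d) - 1)"
  let ?w = "case_sum (\<lambda>a. int (genus \<phi> a) - 1) ?wU"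
  let ?s = "case_sum (\<lambda>y. Inl (lout \<phi> y)) (\<lambda>z. Inr (Inl (lout \<psi> z)))"
  define \<pi> :: "'a + ('b + 'd) \<Rightarrow> 'a + 'c" where "\<pi> = case_sum Inl (\<lambda>p. Inr (f p))"
  have [simp]: "src \<chi> = src \<psi>" "tgt \<chi> = tgt \<tau>" by (fact C.src C.tgt)+
  have gj: "equivclp (glue3 \<phi> \<psi> \<tau>) (Inr p) (Inr q)" if "equivclp (glue \<psi> \<tau>) p q" for p q
    using that by (rule equivclp_map) (auto simp: glue_def glue3_def intro!: r_into_equivclp)
  have "presents (src \<phi>) (tgt \<tau>) ?V (glue3 \<phi> \<psi> \<tau>) ?w ({1..tgt \<phi>} <+> {1..tgt \<psi>}) ?s
     (\<lambda>i. Inl (lin \<phi> i)) (\<lambda>j. Inr (Inr (lout \<tau> j))) (h \<circ> \<pi>) \<xi>"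
  proof (rule presents_refine[where Kb = "Inl ` {1..tgt \<phi>}" and Ka = "Inr ` {1..tgt \<psi>}" and \<sigma> = projl])
    show "presents (src \<phi>) (tgt \<tau>) ?W (glue \<phi> \<chi>)
     (case_sum (\<lambda>a. int (genus \<phi> a) - 1) (\<lambda>b. int (genus \<chi> b) - 1))
     {1..tgt \<phi>} (\<lambda>y. Inl (lout \<phi> y)) (\<lambda>i. Inl (lin \<phi> i)) (\<lambda>j. Inr (lout \<chi> j)) h \<xi>"
      using X by (simp add: comp_via_def)
    show "finite ?V" using cob by (simp add: cob_finite)
    show "\<pi> ` ?V = ?W"
    proof -
      have "\<pi> ` ?V = Inl ` comps \<phi> \<union> Inr ` f ` ?U"
        unfolding Plus_def[of "comps \<phi>"] by (simp add: image_Un image_image \<pi>_def)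
      then show ?thesis by (simp add: C.comps Plus_def[of "comps \<phi>"])
    qed
    show "equivclp (glue3 \<phi> \<psi> \<tau>) p q" if "p \<in> ?V" "q \<in> ?V" and e: "\<pi> p = \<pi> q" for p q
      using that C.ker gj by (cases p; cases q) (auto simp: \<pi>_def)
    show "equivclp (glue \<phi> \<chi>) (\<pi> p) (\<pi> q)" if "glue3 \<phi> \<psi> \<tau> p q" for p q
      using that unfolding glue3_def
    proof (elim disjE bexE conjE)
      fix z assume z: "z \<in> {1..tgt \<psi>}" "p = Inr (Inl (lout \<psi> z))" "q = Inr (Inr (lin \<tau> z))"
      have "glue \<psi> \<tau> (Inl (lout \<psi> z)) (Inr (lin \<tau> z))" using z by (auto simp: glue_def)
      from r_into_equivclp[of "glue \<psi> \<tau>", OF this] have "f (Inl (lout \<psi> z)) = f (Inr (lin \<tau> z))"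
        using C.ker[of "Inl (lout \<psi> z)" "Inr (lin \<tau> z)"] cob z by (auto simp: cob_lin cob_lout InlI InrI)
      then show ?thesis using z by (simp add: \<pi>_def)
    next
      fix y assume y: "y \<in> {1..tgt \<phi>}" "p = Inl (lout \<phi> y)" "q = Inr (Inl (lin \<psi> y))"
      then have "lin \<chi> y = f (Inl (lin \<psi> y))" using cob by (simp add: C.lin)
      then have "glue \<phi> \<chi> (\<pi> p) (\<pi> q)" using y by (auto simp: glue_def \<pi>_def intro!: bexI[of _ y])
      then show ?thesis by (rule r_into_equivclp)
    qed
    show "\<exists>p\<in>?V. \<exists>q\<in>?V. \<pi> p = c \<and> \<pi> q = c' \<and> equivclp (glue3 \<phi> \<psi> \<tau>) p q" if g: "glue \<phi> \<chi> c c'" for c c'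
    proof -
      obtain y where y: "y \<in> {1..tgt \<phi>}" "c = Inl (lout \<phi> y)" "c' = Inr (lin \<chi> y)"
        using g unfolding glue_def by auto
      show ?thesis
      proof (intro bexI conjI)
        show "equivclp (glue3 \<phi> \<psi> \<tau>) (Inl (lout \<phi> y)) (Inr (Inl (lin \<psi> y)))"
          by (rule r_into_equivclp) (use y in \<open>auto simp: glue3_def\<close>)
      qed (use y cob in \<open>auto simp: \<pi>_def C.lin cob_lin cob_lout\<close>)
    qed
    show "Inl (lin \<phi> k) \<in> ?V \<and> \<pi> (Inl (lin \<phi> k)) = Inl (lin \<phi> k)" if "Suc 0 \<le> k" "k \<le> src \<phi>" for k
      using that cob by (simp add: \<pi>_def cob_lin InlI)
    show "Inr (Inr (lout \<tau> k)) \<in> ?V \<and> \<pi> (Inr (Inr (lout \<tau> k))) = Inr (lout \<chi> k)" if "Suc 0 \<le> k" "k \<le> tgt \<tau>" for k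
      using that cob by (simp add: \<pi>_def C.lout cob_lout InrI)
    show "finite ({1..tgt \<phi>} <+> {1..tgt \<psi>})" by simp
    show "{1..tgt \<phi>} <+> {1..tgt \<psi>} = Inr ` {1..tgt \<psi>} \<union> Inl ` {1..tgt \<phi>}" by (auto simp: Plus_def)
    show "Inr ` {1..tgt \<psi>} \<inter> Inl ` {1..tgt \<phi>} = {}" by auto
    show "?s e \<in> ?V" if "e \<in> {1..tgt \<phi>} <+> {1..tgt \<psi>}" for e
      using that cob by (auto simp: cob_lout)
    show "bij_betw projl (Inl ` {1..tgt \<phi>}) {1..tgt \<phi>}"
      by (rule bij_betw_imageI) (auto simp: inj_on_def image_image)
    show "\<pi> (?s e) = Inl (lout \<phi> (projl e))" if "e \<in> Inl ` {1..tgt \<phi>}" for e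
      using that by (auto simp: \<pi>_def)
    fix c assume c: "c \<in> ?W"
    show "case_sum (\<lambda>a. int (genus \<phi> a) - 1) (\<lambda>b. int (genus \<chi> b) - 1) c =
       (\<Sum>p\<in>{p\<in>?V. \<pi> p = c}. ?w p) + int (card {e\<in>Inr ` {1..tgt \<psi>}. \<pi> (?s e) = c})"
    proof (cases c)
      case (Inr x)
      then have x: "x \<in> f ` ?U" using c C.comps by auto
      have "{p\<in>?V. \<pi> p = c} = Inr ` {p\<in>?U. f p = x}"
        using Inr unfolding Plus_def[of "comps \<phi>"] by (auto simp: \<pi>_def)
      then have 1: "(\<Sum>p\<in>{p\<in>?V. \<pi> p = c}. ?w p) = (\<Sum>p\<in>{p\<in>?U. f p = x}. ?wU p)"
        by (simp add: sum.reindex)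
      have "{e\<in>Inr ` {1..tgt \<psi>}. \<pi> (?s e) = c} = Inr ` {y\<in>{1..tgt \<psi>}. f (Inl (lout \<psi> y)) = x}"
        using Inr by (auto simp: \<pi>_def)
      then have 2: "card {e\<in>Inr ` {1..tgt \<psi>}. \<pi> (?s e) = c} = card {y\<in>{1..tgt \<psi>}. f (Inl (lout \<psi> y)) = x}"
        by (simp add: card_image)
      show ?thesis using C.genus[OF x] 1 2 Inr by simp
    next
      case (Inl a)
      have 1: "{p\<in>?V. \<pi> p = c} = {Inl a}" using c Inl by (auto simp: \<pi>_def)
      have 2: "{e\<in>Inr ` {1..tgt \<psi>}. \<pi> (?s e) = c} = {}" using Inl by (auto simp: \<pi>_def)
      show ?thesis unfolding 1 2 using Inl by simp
    qed
  qed
  then show ?thesis unfolding comp3_via_def by blast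
qed

lemma Cob_homE:
  assumes "\<Phi> \<in> Cob_hom m n"
  obtains \<phi> :: "nat cob" where "\<Phi> = cob_class \<phi>" "is_cob \<phi>" "src \<phi> = m" "tgt \<phi> = n"
  using assms unfolding Cob_hom_def by blast

lemma ex_comp_via_nat:
  assumes "is_cob \<phi>" "is_cob \<psi>" "tgt \<phi> = src \<psi>"
  obtains f and \<chi> :: "nat cob" where "comp_via \<phi> \<psi> f \<chi>"
proof -
  note c = comp_cob_comp_via[OF assms]
  obtain \<chi> :: "nat cob" where "cob_equiv (comp_cob \<psi> \<phi>) \<chi>"
    using ex_nat_cob[OF comp_via_cob(1)[OF c]] by blast
  with c show thesis using presents_equiv that unfolding comp_via_def by blast
qed

lemma category_Cob: "category (UNIV :: nat set) Cob_hom Cob_comp Cob_ident"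
proof
  fix m n m' n' \<Phi>
  assume "\<Phi> \<in> Cob_hom m n" "\<Phi> \<in> Cob_hom m' n'"
  then show "m = m' \<and> n = n'"
    by (elim Cob_homE) (metis cob_class_self cob_class_src_tgt)
next
  have id: "is_cob (ident_cob n)" "src (ident_cob n) = n" "tgt (ident_cob n) = n" for n
    by (auto simp: is_cob_def ident_cob_def)
  fix n
  show "Cob_ident n \<in> Cob_hom n n"
    using Cob_hom_class[OF id(1)[of n]] by (simp add: Cob_ident_def id)
  fix m \<Phi> assume "\<Phi> \<in> Cob_hom m n"
  then obtain \<phi> :: "nat cob" where \<phi>: "\<Phi> = cob_class \<phi>" "is_cob \<phi>" "src \<phi> = m" "tgt \<phi> = n"
    by (rule Cob_homE)
  show "Cob_comp \<Phi> (Cob_ident m) = \<Phi>" unfolding \<phi>(1) Cob_ident_def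
    using Cob_comp_class[OF comp_via_ident_right[OF \<phi>(2)]] \<phi> id by simp
  show "Cob_comp (Cob_ident n) \<Phi> = \<Phi>" unfolding \<phi>(1) Cob_ident_def
    using Cob_comp_class[OF comp_via_ident_left[OF \<phi>(2)]] \<phi> id by simp
next
  fix l m n \<Phi> \<Psi> assume "\<Phi> \<in> Cob_hom l m" "\<Psi> \<in> Cob_hom m n"
  then obtain \<phi> \<psi> :: "nat cob" where *: "\<Phi> = cob_class \<phi>" "is_cob \<phi>" "src \<phi> = l" "tgt \<phi> = m"
    "\<Psi> = cob_class \<psi>" "is_cob \<psi>" "src \<psi> = m" "tgt \<psi> = n"
    by (elim Cob_homE) blast
  then obtain f and \<chi> :: "nat cob" where \<chi>: "comp_via \<phi> \<psi> f \<chi>" using ex_comp_via_nat by metis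
  show "Cob_comp \<Psi> \<Phi> \<in> Cob_hom l n"
    using Cob_comp_class[OF \<chi>] Cob_hom_class[OF comp_via_cob(1)[OF \<chi>]] comp_via_cob[OF \<chi>] * by simp
next
  fix k l m n \<Phi> \<Psi> T assume "\<Phi> \<in> Cob_hom k l" "\<Psi> \<in> Cob_hom l m" "T \<in> Cob_hom m n"
  then obtain \<phi> \<psi> \<tau> :: "nat cob" where *: "\<Phi> = cob_class \<phi>" "is_cob \<phi>" "src \<phi> = k" "tgt \<phi> = l"
    "\<Psi> = cob_class \<psi>" "is_cob \<psi>" "src \<psi> = l" "tgt \<psi> = m"
    "T = cob_class \<tau>" "is_cob \<tau>" "src \<tau> = m" "tgt \<tau> = n"
    by (elim Cob_homE) blast
  have l: "tgt \<phi> = src \<psi>" "tgt \<psi> = src \<tau>" using * by auto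
  obtain f1 and \<chi>1 :: "nat cob" where 1: "comp_via \<phi> \<psi> f1 \<chi>1" using ex_comp_via_nat[OF *(2,6) l(1)] by blast
  obtain f2 and \<chi>2 :: "nat cob" where 2: "comp_via \<psi> \<tau> f2 \<chi>2" using ex_comp_via_nat[OF *(6,10) l(2)] by blast
  have l1: "tgt \<chi>1 = src \<tau>" "tgt \<phi> = src \<chi>2" using comp_via_cob[OF 1] comp_via_cob[OF 2] l by auto
  obtain h1 and \<xi>1 :: "nat cob" where h1: "comp_via \<chi>1 \<tau> h1 \<xi>1"
    using ex_comp_via_nat[OF comp_via_cob(1)[OF 1] *(10) l1(1)] by blast
  obtain h2 and \<xi>2 :: "nat cob" where h2: "comp_via \<phi> \<chi>2 h2 \<xi>2"
    using ex_comp_via_nat[OF *(2) comp_via_cob(1)[OF 2] l1(2)] by blast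
  obtain F1 where F1: "comp3_via \<phi> \<psi> \<tau> F1 \<xi>1" using comp3_via_left[OF 1 h1 *(2,6,10) l] by blast
  obtain F2 where F2: "comp3_via \<phi> \<psi> \<tau> F2 \<xi>2" using comp3_via_right[OF 2 h2 *(2,6,10) l] by blast
  have "cob_equiv \<xi>1 \<xi>2" using F1 F2 unfolding comp3_via_def by (rule presents_unique)
  then have eq: "cob_class \<xi>1 = cob_class \<xi>2" by (rule cob_class_eqI[OF comp_via_cob(1)[OF h1]])
  show "Cob_comp T (Cob_comp \<Psi> \<Phi>) = Cob_comp (Cob_comp T \<Psi>) \<Phi>"
    unfolding *(1,5,9) Cob_comp_class[OF 1 *(2,6) l(1)] Cob_comp_class[OF 2 *(6,10) l(2)]
      Cob_comp_class[OF h1 comp_via_cob(1)[OF 1] *(10) l1(1)]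
      Cob_comp_class[OF h2 *(2) comp_via_cob(1)[OF 2] l1(2)] eq ..
qed

end

theory Submission
  imports Defs
begin

text \<open>
  The pushout and the genus formula that define a composite become explicit as soon as one of the
  glued legs is injective. If the outgoing leg of \<open>\<phi>\<close> is injective, gluing only merges each
  component of \<open>\<phi>\<close> that has an outgoing circle into the one component of \<open>\<psi>\<close> that it meets,
  adding its genus (each merged vertex contributes genus minus one, its edge contributes one).
  The components of \<open>\<psi>\<phi>\<close> are those of \<open>\<phi>\<close> without outgoing circle together with those of \<open>\<psi>\<close>.
  Dually, if \<open>\<psi>\<close> is a fibration, each of its components with an incoming circle is a sphere with
  holes and is swallowed without a trace by \<open>\<phi>\<close>; the components of \<open>\<psi>\<phi>\<close> are those of \<open>\<phi>\<close>
  together with those of \<open>\<psi>\<close> without incoming circle. These are \<open>comp_via_absorb_first\<close> and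
  \<open>comp_via_absorb_second\<close>. With them, an equation between composites is a bijection \<open>\<theta>\<close>
  between two disjoint unions, and no quotient has to be handled any more.

  Factorization: cut \<open>\<phi>\<close> along one new circle in each component that has both incoming and outgoing
  circles. The genus stays on the incoming side; components without incoming circle go to the
  fibration if they have an outgoing one, all other components to the cofibration.

  Orthogonality (\<open>diagonal_exists\<close>): a square \<open>v e = r u\<close> is a bijection
  \<open>\<theta> : A\<^sub>0 + B \<rightarrow> U + D\<^sub>0\<close>, where \<open>B\<close>, \<open>U\<close> are the components of \<open>v\<close>, \<open>u\<close>, while
  \<open>A\<^sub>0\<close> consists of the components of \<open>e\<close> without outgoing circle and \<open>D\<^sub>0\<close> of those of \<open>r\<close>
  without incoming circle. Components in \<open>D\<^sub>0\<close> have outgoing circles and those in \<open>A\<^sub>0\<close> have none,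
  so \<open>\<theta>\<close> sends \<open>A\<^sub>0\<close> into \<open>U\<close>. Hence \<open>\<theta>\<close> identifies \<open>B\<close> without the preimage of \<open>D\<^sub>0\<close> with
  \<open>U\<close> without the image of \<open>A\<^sub>0\<close>, and this common part is the component set of the diagonal. The
  diagonal is unique because fibrations are monomorphisms (\<open>fibration_left_cancel\<close>): a bijection
  \<open>W + D\<^sub>0 \<rightarrow> W' + D\<^sub>0\<close> compatible with the outgoing circles has to fix \<open>D\<^sub>0\<close> pointwise.
\<close>

section \<open>Composites along an injective leg\<close>

definition no_out :: "'a cob \<Rightarrow> 'a set" where
  "no_out \<phi> = comps \<phi> - lout \<phi> ` {1..tgt \<phi>}"

definition no_in :: "'a cob \<Rightarrow> 'a set" where
  "no_in \<psi> = comps \<psi> - lin \<psi> ` {1..src \<psi>}"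

text \<open>\<open>push_out\<close> and \<open>pull_in\<close> move a component across the glued circle it carries; they send every
  component to the representative of its gluing class in the models \<open>absorb_first\<close> and
  \<open>absorb_second\<close>. The chosen circle \<^const>\<open>inv_into\<close> is the only one under injectivity of the leg.\<close>

definition push_out :: "'a cob \<Rightarrow> 'b cob \<Rightarrow> 'a \<Rightarrow> 'a + 'b" where
  "push_out \<phi> \<psi> a = (if a \<in> lout \<phi> ` {1..tgt \<phi>}
     then Inr (lin \<psi> (inv_into {1..tgt \<phi>} (lout \<phi>) a)) else Inl a)"

definition pull_in :: "'a cob \<Rightarrow> 'b cob \<Rightarrow> 'b \<Rightarrow> 'a + 'b" where
  "pull_in \<phi> \<psi> b = (if b \<in> lin \<psi> ` {1..src \<psi>}
     then Inl (lout \<phi> (inv_into {1..src \<psi>} (lin \<psi>) b)) else Inr b)"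

text \<open>\<open>absorb_first \<phi> \<psi>\<close> models the composite \<open>\<psi>\<phi>\<close> when \<open>lout \<phi>\<close> is injective, and
  \<open>absorb_second \<phi> \<psi>\<close> models the same composite when \<open>lin \<psi>\<close> is injective with genus \<open>0\<close> on its
  image; outside these cases they have no meaning.\<close>

definition absorb_first :: "'a cob \<Rightarrow> 'b cob \<Rightarrow> ('a + 'b) cob" where
  "absorb_first \<phi> \<psi> = \<lparr>src = src \<phi>, tgt = tgt \<psi>, comps = no_out \<phi> <+> comps \<psi>,
     lin = (\<lambda>i. push_out \<phi> \<psi> (lin \<phi> i)), lout = (\<lambda>j. Inr (lout \<psi> j)),
     genus = case_sum (genus \<phi>)
       (\<lambda>b. genus \<psi> b + (\<Sum>y\<in>{y\<in>{1..tgt \<phi>}. lin \<psi> y = b}. genus \<phi> (lout \<phi> y)))\<rparr>"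

definition absorb_second :: "'a cob \<Rightarrow> 'b cob \<Rightarrow> ('a + 'b) cob" where
  "absorb_second \<phi> \<psi> = \<lparr>src = src \<phi>, tgt = tgt \<psi>, comps = comps \<phi> <+> no_in \<psi>,
     lin = (\<lambda>i. Inl (lin \<phi> i)), lout = (\<lambda>j. pull_in \<phi> \<psi> (lout \<psi> j)),
     genus = case_sum (genus \<phi>) (genus \<psi>)\<rparr>"

lemma absorb_first_sel:
  "src (absorb_first \<phi> \<psi>) = src \<phi>" "tgt (absorb_first \<phi> \<psi>) = tgt \<psi>"
  "comps (absorb_first \<phi> \<psi>) = no_out \<phi> <+> comps \<psi>"
  "lin (absorb_first \<phi> \<psi>) i = push_out \<phi> \<psi> (lin \<phi> i)"
  "lout (absorb_first \<phi> \<psi>) j = Inr (lout \<psi> j)"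
  "genus (absorb_first \<phi> \<psi>) = case_sum (genus \<phi>)
     (\<lambda>b. genus \<psi> b + (\<Sum>y\<in>{y\<in>{1..tgt \<phi>}. lin \<psi> y = b}. genus \<phi> (lout \<phi> y)))"
  by (simp_all add: absorb_first_def)

lemma absorb_second_sel:
  "src (absorb_second \<phi> \<psi>) = src \<phi>" "tgt (absorb_second \<phi> \<psi>) = tgt \<psi>"
  "comps (absorb_second \<phi> \<psi>) = comps \<phi> <+> no_in \<psi>"
  "lin (absorb_second \<phi> \<psi>) i = Inl (lin \<phi> i)"
  "lout (absorb_second \<phi> \<psi>) j = pull_in \<phi> \<psi> (lout \<psi> j)"
  "genus (absorb_second \<phi> \<psi>) = case_sum (genus \<phi>) (genus \<psi>)"
  by (simp_all add: absorb_second_def)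

lemma push_out_lout:
  "inj_on (lout \<phi>) {1..tgt \<phi>} \<Longrightarrow> y \<in> {1..tgt \<phi>} \<Longrightarrow> push_out \<phi> \<psi> (lout \<phi> y) = Inr (lin \<psi> y)"
  unfolding push_out_def by (subst inv_into_f_f) auto

lemma push_out_cases:
  assumes "inj_on (lout \<phi>) {1..tgt \<phi>}" "a \<in> comps \<phi>"
  obtains y where "y \<in> {1..tgt \<phi>}" "a = lout \<phi> y" "push_out \<phi> \<psi> a = Inr (lin \<psi> y)"
  | "a \<in> no_out \<phi>" "push_out \<phi> \<psi> a = Inl a"
proof (cases "a \<in> lout \<phi> ` {1..tgt \<phi>}")
  case True
  then obtain y where "y \<in> {1..tgt \<phi>}" "a = lout \<phi> y" by blast
  then show thesis using that(1) push_out_lout[OF assms(1)] by metis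
next
  case False
  then show thesis using that(2) assms(2) by (simp add: no_out_def push_out_def)
qed

lemma pull_in_lin:
  "inj_on (lin \<psi>) {1..src \<psi>} \<Longrightarrow> y \<in> {1..src \<psi>} \<Longrightarrow> pull_in \<phi> \<psi> (lin \<psi> y) = Inl (lout \<phi> y)"
  unfolding pull_in_def by (subst inv_into_f_f) auto

lemma pull_in_cases:
  assumes "inj_on (lin \<psi>) {1..src \<psi>}" "b \<in> comps \<psi>"
  obtains y where "y \<in> {1..src \<psi>}" "b = lin \<psi> y" "pull_in \<phi> \<psi> b = Inl (lout \<phi> y)"
  | "b \<in> no_in \<psi>" "pull_in \<phi> \<psi> b = Inr b"
proof (cases "b \<in> lin \<psi> ` {1..src \<psi>}")
  case True
  then obtain y where "y \<in> {1..src \<psi>}" "b = lin \<psi> y" by blast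
  then show thesis using that(1) pull_in_lin[OF assms(1)] by metis
next
  case False
  then show thesis using that(2) assms(2) by (simp add: no_in_def pull_in_def)
qed

text \<open>A map that is constant on glued pairs and moves each point only within its class is a normal
  form for the generated equivalence. This decides equality in the pushout.\<close>

lemma equivclp_normal_form:
  assumes glued: "\<And>p q. R p q \<Longrightarrow> \<rho> p = \<rho> q" and step: "\<And>p. equivclp R p (\<rho> p)"
  shows "\<rho> p = \<rho> q \<longleftrightarrow> equivclp R p q"
proof
  assume "\<rho> p = \<rho> q"
  then show "equivclp R p q"
    using equivclp_trans[OF step[of p]] equivclp_sym[OF step[of q]] by simp
next
  assume "equivclp R p q"
  then show "\<rho> p = \<rho> q"
    by induction (auto dest: glued)
qed

text \<open>The fibre over a component \<open>b\<close> of \<open>\<psi>\<close> is a star: \<open>b\<close> is its centre, and each circle glued to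
  \<open>b\<close> is an edge to a leaf of its own, by injectivity. Edges and leaves cancel in the genus formula, up
  to the genera of the leaves. The fibre over a component of \<open>\<phi>\<close> without outgoing circle is a
  single point.\<close>

lemma comp_via_absorb_first:
  fixes \<phi> :: "'a cob" and \<psi> :: "'b cob"
  assumes \<phi>: "is_cob \<phi>" and \<psi>: "is_cob \<psi>" and eq: "tgt \<phi> = src \<psi>"
    and inj: "inj_on (lout \<phi>) {1..tgt \<phi>}"
  shows "comp_via \<phi> \<psi> (case_sum (push_out \<phi> \<psi>) Inr) (absorb_first \<phi> \<psi>)"
proof -
  let ?V = "comps \<phi> <+> comps \<psi>" and ?\<rho> = "case_sum (push_out \<phi> \<psi>) Inr"
  let ?w = "case_sum (\<lambda>a. int (genus \<phi> a) - 1) (\<lambda>b. int (genus \<psi> b) - 1)"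
  note push = push_out_lout[OF inj, where \<psi> = \<psi>]
  have fin: "finite (comps \<phi>)" "finite (comps \<psi>)" using \<phi> \<psi> by (simp_all add: cob_finite)
  have lin\<psi>: "lin \<psi> y \<in> comps \<psi>" if "y \<in> {1..tgt \<phi>}" for y
    using cob_lin[OF \<psi>] eq that by simp
  have lout\<phi>: "lout \<phi> y \<in> comps \<phi>" if "y \<in> {1..tgt \<phi>}" for y
    using cob_lout[OF \<phi>] that by simp
  have ker: "?\<rho> p = ?\<rho> q \<longleftrightarrow> equivclp (glue \<phi> \<psi>) p q" for p q
  proof (rule equivclp_normal_form)
    show "?\<rho> p = ?\<rho> q" if "glue \<phi> \<psi> p q" for p q
      using that push by (auto simp: glue_def)
    show "equivclp (glue \<phi> \<psi>) p (?\<rho> p)" for p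
    proof (cases "\<exists>y\<in>{1..tgt \<phi>}. p = Inl (lout \<phi> y)")
      case True
      then have "glue \<phi> \<psi> p (?\<rho> p)" using push by (auto simp: glue_def)
      then show ?thesis by (rule r_into_equivclp)
    next
      case False
      then have "?\<rho> p = p" by (auto simp: push_out_def split: sum.split)
      then show ?thesis by simp
    qed
  qed
  have image: "?\<rho> ` ?V = no_out \<phi> <+> comps \<psi>"
  proof
    show "?\<rho> ` ?V \<subseteq> no_out \<phi> <+> comps \<psi>"
      using lin\<psi> by (auto elim!: push_out_cases[OF inj, where \<psi> = \<psi>])
    show "no_out \<phi> <+> comps \<psi> \<subseteq> ?\<rho> ` ?V"
    proof
      fix x assume x: "x \<in> no_out \<phi> <+> comps \<psi>"
      then have "x \<in> ?V" "?\<rho> x = x" by (auto simp: no_out_def push_out_def)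
      then show "x \<in> ?\<rho> ` ?V" by (metis imageI)
    qed
  qed
  have genus: "int (genus (absorb_first \<phi> \<psi>) x) =
      1 + (\<Sum>p\<in>{p\<in>?V. ?\<rho> p = x}. ?w p) + int (card {y\<in>{1..tgt \<phi>}. ?\<rho> (Inl (lout \<phi> y)) = x})"
    if "x \<in> ?\<rho> ` ?V" for x
  proof -
    from that have x: "x \<in> no_out \<phi> <+> comps \<psi>" by (simp only: image)
    have split: "(\<Sum>p\<in>{p\<in>?V. ?\<rho> p = x}. ?w p) =
        (\<Sum>a\<in>{a\<in>comps \<phi>. push_out \<phi> \<psi> a = x}. int (genus \<phi> a) - 1) +
        (\<Sum>b\<in>{b\<in>comps \<psi>. Inr b = x}. int (genus \<psi> b) - 1)"
      by (simp only: sum_Plus_fibre[OF fin] sum.case)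
    show ?thesis
    proof (cases x)
      case (Inl a)
      then have a: "a \<in> no_out \<phi>" using x by auto
      have 1: "{a'\<in>comps \<phi>. push_out \<phi> \<psi> a' = x} = {a}"
        using a Inl by (auto simp: no_out_def push_out_def)
      have 2: "{y\<in>{1..tgt \<phi>}. ?\<rho> (Inl (lout \<phi> y)) = x} = {}" using Inl push by auto
      show ?thesis unfolding split 1 2 using Inl by (simp add: absorb_first_def)
    next
      case (Inr b)
      then have b: "b \<in> comps \<psi>" using x by auto
      let ?Y = "{y\<in>{1..tgt \<phi>}. lin \<psi> y = b}"
      have 1: "{a\<in>comps \<phi>. push_out \<phi> \<psi> a = x} = lout \<phi> ` ?Y"
        using Inr lout\<phi> push by (auto elim!: push_out_cases[OF inj, where \<psi> = \<psi>])
      have 2: "{y\<in>{1..tgt \<phi>}. ?\<rho> (Inl (lout \<phi> y)) = x} = ?Y" using Inr push by auto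
      have 3: "{b'\<in>comps \<psi>. Inr b' = x} = {b}" using b Inr by auto
      have "inj_on (lout \<phi>) ?Y" using inj by (rule inj_on_subset) auto
      then have "(\<Sum>a\<in>lout \<phi> ` ?Y. int (genus \<phi> a) - 1) = (\<Sum>y\<in>?Y. int (genus \<phi> (lout \<phi> y))) - int (card ?Y)"
        by (simp add: sum.reindex sum_subtractf card_image)
      then show ?thesis unfolding split 1 2 3 using Inr by (simp add: absorb_first_def)
    qed
  qed
  show ?thesis unfolding comp_via_def
  proof unfold_locales
    show "comps (absorb_first \<phi> \<psi>) = ?\<rho> ` ?V" unfolding image by (simp add: absorb_first_def)
    show "?\<rho> p = ?\<rho> q \<longleftrightarrow> equivclp (glue \<phi> \<psi>) p q" for p q by (rule ker)
    show "int (genus (absorb_first \<phi> \<psi>) x) =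
      1 + (\<Sum>p\<in>{p\<in>?V. ?\<rho> p = x}. ?w p) + int (card {y\<in>{1..tgt \<phi>}. ?\<rho> (Inl (lout \<phi> y)) = x})"
      if "x \<in> ?\<rho> ` ?V" for x using that by (rule genus)
  qed (use fin in \<open>simp_all add: absorb_first_def InlI InrI cob_lin[OF \<phi>] cob_lout[OF \<psi>] cob_lout[OF \<phi>]\<close>)
qed

text \<open>The same stars with the roles of the two cobordisms exchanged; here the leaves have genus \<open>0\<close>,
  so the genus of the centre does not change.\<close>

lemma comp_via_absorb_second:
  fixes \<phi> :: "'a cob" and \<psi> :: "'b cob"
  assumes \<phi>: "is_cob \<phi>" and \<psi>: "is_cob \<psi>" and eq: "tgt \<phi> = src \<psi>"
    and inj: "inj_on (lin \<psi>) {1..src \<psi>}" and genus0: "\<forall>y\<in>{1..src \<psi>}. genus \<psi> (lin \<psi> y) = 0"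
  shows "comp_via \<phi> \<psi> (case_sum Inl (pull_in \<phi> \<psi>)) (absorb_second \<phi> \<psi>)"
proof -
  let ?V = "comps \<phi> <+> comps \<psi>" and ?\<rho> = "case_sum Inl (pull_in \<phi> \<psi>)"
  let ?w = "case_sum (\<lambda>a. int (genus \<phi> a) - 1) (\<lambda>b. int (genus \<psi> b) - 1)"
  note pull = pull_in_lin[OF inj, where \<phi> = \<phi>]
  have fin: "finite (comps \<phi>)" "finite (comps \<psi>)" using \<phi> \<psi> by (simp_all add: cob_finite)
  have lin\<psi>: "lin \<psi> y \<in> comps \<psi>" if "y \<in> {1..src \<psi>}" for y
    using cob_lin[OF \<psi>] that by simp
  have lout\<phi>: "lout \<phi> y \<in> comps \<phi>" if "y \<in> {1..src \<psi>}" for y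
    using cob_lout[OF \<phi>] eq that by simp
  have ker: "?\<rho> p = ?\<rho> q \<longleftrightarrow> equivclp (glue \<phi> \<psi>) p q" for p q
  proof (rule equivclp_normal_form)
    show "?\<rho> p = ?\<rho> q" if "glue \<phi> \<psi> p q" for p q
      using that pull eq by (auto simp: glue_def)
    show "equivclp (glue \<phi> \<psi>) p (?\<rho> p)" for p
    proof (cases "\<exists>y\<in>{1..src \<psi>}. p = Inr (lin \<psi> y)")
      case True
      then have "glue \<phi> \<psi> (?\<rho> p) p" using pull eq by (auto simp: glue_def)
      then show ?thesis by (intro equivclp_sym[OF r_into_equivclp])
    next
      case False
      then have "?\<rho> p = p" by (auto simp: pull_in_def split: sum.split)
      then show ?thesis by simp
    qed
  qed
  have image: "?\<rho> ` ?V = comps \<phi> <+> no_in \<psi>"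
  proof
    show "?\<rho> ` ?V \<subseteq> comps \<phi> <+> no_in \<psi>"
      using lout\<phi> by (auto elim!: pull_in_cases[OF inj, where \<phi> = \<phi>])
    show "comps \<phi> <+> no_in \<psi> \<subseteq> ?\<rho> ` ?V"
    proof
      fix x assume x: "x \<in> comps \<phi> <+> no_in \<psi>"
      then have "x \<in> ?V" "?\<rho> x = x" by (auto simp: no_in_def pull_in_def)
      then show "x \<in> ?\<rho> ` ?V" by (metis imageI)
    qed
  qed
  have genus: "int (genus (absorb_second \<phi> \<psi>) x) =
      1 + (\<Sum>p\<in>{p\<in>?V. ?\<rho> p = x}. ?w p) + int (card {y\<in>{1..tgt \<phi>}. ?\<rho> (Inl (lout \<phi> y)) = x})"
    if "x \<in> ?\<rho> ` ?V" for x
  proof -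
    from that have x: "x \<in> comps \<phi> <+> no_in \<psi>" by (simp only: image)
    have split: "(\<Sum>p\<in>{p\<in>?V. ?\<rho> p = x}. ?w p) =
        (\<Sum>a\<in>{a\<in>comps \<phi>. Inl a = x}. int (genus \<phi> a) - 1) +
        (\<Sum>b\<in>{b\<in>comps \<psi>. pull_in \<phi> \<psi> b = x}. int (genus \<psi> b) - 1)"
      by (simp only: sum_Plus_fibre[OF fin] sum.case)
    show ?thesis
    proof (cases x)
      case (Inr b)
      then have b: "b \<in> no_in \<psi>" using x by auto
      have 1: "{b'\<in>comps \<psi>. pull_in \<phi> \<psi> b' = x} = {b}"
        using b Inr by (auto simp: no_in_def pull_in_def)
      show ?thesis unfolding split 1 using Inr by (simp add: absorb_second_def)
    next
      case (Inl a)
      then have a: "a \<in> comps \<phi>" using x by auto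
      let ?Y = "{y\<in>{1..src \<psi>}. lout \<phi> y = a}"
      have 1: "{b\<in>comps \<psi>. pull_in \<phi> \<psi> b = x} = lin \<psi> ` ?Y"
        using Inl lin\<psi> pull by (auto elim!: pull_in_cases[OF inj, where \<phi> = \<phi>])
      have 2: "{y\<in>{1..tgt \<phi>}. ?\<rho> (Inl (lout \<phi> y)) = x} = ?Y" using Inl eq by auto
      have 3: "{a'\<in>comps \<phi>. Inl a' = x} = {a}" using a Inl by auto
      have "inj_on (lin \<psi>) ?Y" using inj by (rule inj_on_subset) auto
      then have "(\<Sum>b\<in>lin \<psi> ` ?Y. int (genus \<psi> b) - 1) = - int (card ?Y)"
        using genus0 by (simp add: sum.reindex)
      then show ?thesis unfolding split 1 2 3 using Inl by (simp add: absorb_second_def)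
    qed
  qed
  show ?thesis unfolding comp_via_def
  proof unfold_locales
    show "comps (absorb_second \<phi> \<psi>) = ?\<rho> ` ?V" unfolding image by (simp add: absorb_second_def)
    show "?\<rho> p = ?\<rho> q \<longleftrightarrow> equivclp (glue \<phi> \<psi>) p q" for p q by (rule ker)
    show "int (genus (absorb_second \<phi> \<psi>) x) =
      1 + (\<Sum>p\<in>{p\<in>?V. ?\<rho> p = x}. ?w p) + int (card {y\<in>{1..tgt \<phi>}. ?\<rho> (Inl (lout \<phi> y)) = x})"
      if "x \<in> ?\<rho> ` ?V" for x using that by (rule genus)
  qed (use fin in \<open>simp_all add: absorb_second_def InlI InrI cob_lin[OF \<phi>] cob_lout[OF \<psi>] cob_lout[OF \<phi>]\<close>)
qed


lemma Cob_comp_absorb_first: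
  assumes "is_cob \<phi>" "is_cob \<psi>" "tgt \<phi> = src \<psi>" "inj_on (lout \<phi>) {1..tgt \<phi>}"
  shows "is_cob (absorb_first \<phi> \<psi>)"
    and "Cob_comp (cob_class \<psi>) (cob_class \<phi>) = cob_class (absorb_first \<phi> \<psi>)"
  using comp_via_cob(1)[OF comp_via_absorb_first[OF assms]]
    Cob_comp_class[OF comp_via_absorb_first[OF assms] assms(1-3)] by auto

lemma Cob_comp_absorb_second:
  assumes "is_cob \<phi>" "is_cob \<psi>" "tgt \<phi> = src \<psi>" "is_fibration \<psi>"
  shows "is_cob (absorb_second \<phi> \<psi>)"
    and "Cob_comp (cob_class \<psi>) (cob_class \<phi>) = cob_class (absorb_second \<phi> \<psi>)"
proof -
  have "inj_on (lin \<psi>) {1..src \<psi>}" "\<forall>y\<in>{1..src \<psi>}. genus \<psi> (lin \<psi> y) = 0"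
    using assms(4) by (auto simp: is_fibration_def)
  note c = comp_via_absorb_second[OF assms(1-3) this]
  show "is_cob (absorb_second \<phi> \<psi>)"
    "Cob_comp (cob_class \<psi>) (cob_class \<phi>) = cob_class (absorb_second \<phi> \<psi>)"
    using comp_via_cob(1)[OF c] Cob_comp_class[OF c assms(1-3)] by auto
qed

section \<open>Cofibrations and fibrations as classes of morphisms\<close>

text \<open>\<^const>\<open>cob_equiv\<close> with a named bijection, and with bijectivity split into injectivity and
  image, since the arguments below follow single components along \<open>\<theta>\<close>.\<close>

definition cob_iso :: "('a \<Rightarrow> 'b) \<Rightarrow> 'a cob \<Rightarrow> 'b cob \<Rightarrow> bool" where
  "cob_iso \<theta> \<phi> \<psi> \<longleftrightarrow> src \<phi> = src \<psi> \<and> tgt \<phi> = tgt \<psi> \<and>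
     inj_on \<theta> (comps \<phi>) \<and> \<theta> ` comps \<phi> = comps \<psi> \<and>
     (\<forall>i\<in>{1..src \<phi>}. \<theta> (lin \<phi> i) = lin \<psi> i) \<and>
     (\<forall>j\<in>{1..tgt \<phi>}. \<theta> (lout \<phi> j) = lout \<psi> j) \<and>
     (\<forall>c\<in>comps \<phi>. genus \<psi> (\<theta> c) = genus \<phi> c)"

lemma cob_equiv_iff_iso: "cob_equiv \<phi> \<psi> \<longleftrightarrow> (\<exists>\<theta>. cob_iso \<theta> \<phi> \<psi>)"
  unfolding cob_equiv_def cob_iso_def bij_betw_def by simp

lemma cob_isoD:
  assumes "cob_iso \<theta> \<phi> \<psi>"
  shows "src \<phi> = src \<psi>" "tgt \<phi> = tgt \<psi>" "inj_on \<theta> (comps \<phi>)" "\<theta> ` comps \<phi> = comps \<psi>"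
    "\<And>i. i \<in> {1..src \<phi>} \<Longrightarrow> \<theta> (lin \<phi> i) = lin \<psi> i"
    "\<And>j. j \<in> {1..tgt \<phi>} \<Longrightarrow> \<theta> (lout \<phi> j) = lout \<psi> j"
    "\<And>c. c \<in> comps \<phi> \<Longrightarrow> genus \<psi> (\<theta> c) = genus \<phi> c"
  using assms by (simp_all add: cob_iso_def)

lemma cob_equivI:
  assumes "src \<phi> = src \<psi>" "tgt \<phi> = tgt \<psi>" "inj_on \<theta> (comps \<phi>)" "\<theta> ` comps \<phi> = comps \<psi>"
    "\<And>i. i \<in> {1..src \<phi>} \<Longrightarrow> \<theta> (lin \<phi> i) = lin \<psi> i"
    "\<And>j. j \<in> {1..tgt \<phi>} \<Longrightarrow> \<theta> (lout \<phi> j) = lout \<psi> j"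
    "\<And>c. c \<in> comps \<phi> \<Longrightarrow> genus \<psi> (\<theta> c) = genus \<phi> c"
  shows "cob_equiv \<phi> \<psi>"
  using assms unfolding cob_equiv_def bij_betw_def by blast

lemma cob_class_eq_iff:
  assumes "is_cob \<phi>" "is_cob \<chi>"
  shows "cob_class \<phi> = cob_class \<chi> \<longleftrightarrow> cob_equiv \<phi> \<chi>"
proof
  assume eq: "cob_class \<phi> = cob_class \<chi>"
  obtain \<xi> :: "nat cob" where \<xi>: "is_cob \<xi>" "cob_equiv \<phi> \<xi>" using ex_nat_cob[OF assms(1)] by blast
  then have "cob_equiv \<chi> \<xi>" using eq unfolding cob_class_def by blast
  then show "cob_equiv \<phi> \<chi>" using \<xi>(2) assms(2) by (metis cob_equiv_sym cob_equiv_trans)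
qed (rule cob_class_eqI[OF assms(1)])

lemma is_cofibration_equiv:
  assumes \<phi>: "is_cob \<phi>" and "cob_equiv \<phi> \<psi>" and cof: "is_cofibration \<phi>"
  shows "is_cofibration \<psi>"
proof -
  from assms(2) obtain \<theta> where "cob_iso \<theta> \<phi> \<psi>" by (auto simp: cob_equiv_iff_iso)
  note \<theta> = cob_isoD[OF this]
  obtain u where u: "u \<in> {1..tgt \<phi>} \<rightarrow> {1..src \<phi>}" "\<forall>j\<in>{1..tgt \<phi>}. lout \<phi> j = lin \<phi> (u j)"
    using cof unfolding is_cofibration_def by blast
  have "inj_on (\<theta> \<circ> lout \<phi>) {1..tgt \<phi>}"
    using cof cob_lout[OF \<phi>]
    by (intro comp_inj_on inj_on_subset[OF \<theta>(3)]) (auto simp: is_cofibration_def)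
  then have "inj_on (lout \<psi>) {1..tgt \<psi>}"
    using \<theta>(2,6) by (metis (no_types, lifting) comp_apply inj_on_cong)
  moreover have "lout \<psi> j = lin \<psi> (u j)" if "j \<in> {1..tgt \<psi>}" for j
    using that u \<theta>(2) \<theta>(5)[of "u j"] \<theta>(6)[of j] by (metis PiE)
  ultimately show ?thesis using u(1) \<theta>(1,2) unfolding is_cofibration_def by auto
qed

lemma is_fibration_equiv:
  assumes \<phi>: "is_cob \<phi>" and "cob_equiv \<phi> \<psi>" and fib: "is_fibration \<phi>"
  shows "is_fibration \<psi>"
proof -
  from assms(2) obtain \<theta> where "cob_iso \<theta> \<phi> \<psi>" by (auto simp: cob_equiv_iff_iso)
  note \<theta> = cob_isoD[OF this]
  have "inj_on (\<theta> \<circ> lin \<phi>) {1..src \<phi>}"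
    using fib cob_lin[OF \<phi>]
    by (intro comp_inj_on inj_on_subset[OF \<theta>(3)]) (auto simp: is_fibration_def)
  then have "inj_on (lin \<psi>) {1..src \<psi>}"
    using \<theta>(1,5) by (metis (no_types, lifting) comp_apply inj_on_cong)
  moreover have "lout \<psi> ` {1..tgt \<psi>} = \<theta> ` lout \<phi> ` {1..tgt \<phi>}"
    using \<theta>(2,6) by (simp add: image_image)
  moreover have "genus \<psi> (lin \<psi> i) = 0" if "i \<in> {1..src \<psi>}" for i
  proof -
    have "lin \<phi> i \<in> comps \<phi>" "genus \<phi> (lin \<phi> i) = 0"
      using that fib \<phi> \<theta>(1) by (auto simp: is_fibration_def cob_lin)
    then show ?thesis using that \<theta>(1) \<theta>(5)[of i] \<theta>(7)[of "lin \<phi> i"] by simp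
  qed
  ultimately show ?thesis using fib \<theta>(4) unfolding is_fibration_def by auto
qed

text \<open>By invariance under equivalence, membership of a class can be tested on any representative,
  over any type, in particular on the sum-type models of composites.\<close>

lemma cob_class_cofibrations:
  assumes "is_cob \<phi>" shows "cob_class \<phi> \<in> cofibrations \<longleftrightarrow> is_cofibration \<phi>"
proof
  assume "cob_class \<phi> \<in> cofibrations"
  then obtain \<chi> :: "nat cob" where "is_cob \<chi>" "cob_equiv \<phi> \<chi>" "is_cofibration \<chi>"
    by (auto simp: cofibrations_def cob_class_def)
  then show "is_cofibration \<phi>" using assms cob_equiv_sym is_cofibration_equiv by blast
next
  assume "is_cofibration \<phi>"
  moreover obtain \<chi> :: "nat cob" where "is_cob \<chi>" "cob_equiv \<phi> \<chi>" using ex_nat_cob[OF assms] by blast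
  ultimately have "\<exists>\<chi>\<in>cob_class \<phi>. is_cofibration \<chi>"
    using is_cofibration_equiv[OF assms] by (auto simp: cob_class_def)
  then show "cob_class \<phi> \<in> cofibrations"
    using Cob_hom_class[OF assms] by (auto simp: cofibrations_def)
qed

lemma cob_class_fibrations:
  assumes "is_cob \<phi>" shows "cob_class \<phi> \<in> fibrations \<longleftrightarrow> is_fibration \<phi>"
proof
  assume "cob_class \<phi> \<in> fibrations"
  then obtain \<chi> :: "nat cob" where "is_cob \<chi>" "cob_equiv \<phi> \<chi>" "is_fibration \<chi>"
    by (auto simp: fibrations_def cob_class_def)
  then show "is_fibration \<phi>" using assms cob_equiv_sym is_fibration_equiv by blast
next
  assume "is_fibration \<phi>"
  moreover obtain \<chi> :: "nat cob" where "is_cob \<chi>" "cob_equiv \<phi> \<chi>" using ex_nat_cob[OF assms] by blast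
  ultimately have "\<exists>\<chi>\<in>cob_class \<phi>. is_fibration \<chi>"
    using is_fibration_equiv[OF assms] by (auto simp: cob_class_def)
  then show "cob_class \<phi> \<in> fibrations"
    using Cob_hom_class[OF assms] by (auto simp: fibrations_def)
qed

section \<open>Closure under composition, and isomorphisms\<close>

text \<open>A component \<open>lout \<psi> j = lin \<psi> (v j)\<close> absorbs the component \<open>lout \<phi> (v j) = lin \<phi> (u (v j))\<close> of
  \<open>\<phi>\<close>, so the incoming circle \<open>u (v j)\<close> ends on it.\<close>

lemma is_cofibration_absorb_first:
  assumes \<phi>: "is_cofibration \<phi>" and \<psi>: "is_cofibration \<psi>" and eq: "tgt \<phi> = src \<psi>"
  shows "is_cofibration (absorb_first \<phi> \<psi>)"
proof -
  obtain u where u: "u \<in> {1..tgt \<phi>} \<rightarrow> {1..src \<phi>}" "\<forall>j\<in>{1..tgt \<phi>}. lout \<phi> j = lin \<phi> (u j)"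
    and inj: "inj_on (lout \<phi>) {1..tgt \<phi>}"
    using \<phi> unfolding is_cofibration_def by blast
  obtain v where v: "v \<in> {1..tgt \<psi>} \<rightarrow> {1..src \<psi>}" "\<forall>j\<in>{1..tgt \<psi>}. lout \<psi> j = lin \<psi> (v j)"
    and inj': "inj_on (lout \<psi>) {1..tgt \<psi>}"
    using \<psi> unfolding is_cofibration_def by blast
  have "Inr (lout \<psi> j) = push_out \<phi> \<psi> (lin \<phi> ((u \<circ> v) j))" if j: "j \<in> {1..tgt \<psi>}" for j
  proof -
    have vj: "v j \<in> {1..tgt \<phi>}" using v(1) j eq by auto
    have "lin \<phi> (u (v j)) = lout \<phi> (v j)" using u(2) vj by simp
    then show ?thesis using push_out_lout[OF inj vj, where \<psi> = \<psi>] v(2) j by simp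
  qed
  moreover have "u \<circ> v \<in> {1..tgt \<psi>} \<rightarrow> {1..src \<phi>}" using u(1) v(1) eq by (auto simp: Pi_iff)
  moreover have "inj_on (lout (absorb_first \<phi> \<psi>)) {1..tgt \<psi>}"
    using inj' by (simp add: absorb_first_def inj_on_def del: atLeastAtMost_iff)
  moreover have "src (absorb_first \<phi> \<psi>) = src \<phi>" "tgt (absorb_first \<phi> \<psi>) = tgt \<psi>"
    "lin (absorb_first \<phi> \<psi>) i = push_out \<phi> \<psi> (lin \<phi> i)"
    "lout (absorb_first \<phi> \<psi>) i = Inr (lout \<psi> i)" for i
    by (simp_all add: absorb_first_def)
  ultimately show ?thesis unfolding is_cofibration_def by metis
qed

text \<open>Only surjectivity of the outgoing leg needs an argument: a component \<open>lout \<phi> y\<close> has absorbed the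
  component \<open>lin \<psi> y\<close>, and this one has an outgoing circle because \<open>\<psi>\<close> is a fibration.\<close>

lemma is_fibration_absorb_second:
  fixes \<phi> :: "'a cob" and \<psi> :: "'b cob"
  assumes cob: "is_cob \<psi>" and \<phi>: "is_fibration \<phi>" and \<psi>: "is_fibration \<psi>" and eq: "tgt \<phi> = src \<psi>"
  shows "is_fibration (absorb_second \<phi> \<psi>)"
proof -
  have inj: "inj_on (lin \<psi>) {1..src \<psi>}" using \<psi> by (simp add: is_fibration_def)
  have surj: "lout \<phi> ` {1..src \<psi>} = comps \<phi>" "lout \<psi> ` {1..tgt \<psi>} = comps \<psi>"
    using \<phi> \<psi> eq by (simp_all add: is_fibration_def)
  have "pull_in \<phi> \<psi> ` comps \<psi> = comps \<phi> <+> no_in \<psi>"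
  proof
    show "pull_in \<phi> \<psi> ` comps \<psi> \<subseteq> comps \<phi> <+> no_in \<psi>"
      using surj(1) by (auto elim!: pull_in_cases[OF inj, where \<phi> = \<phi>])
    show "comps \<phi> <+> no_in \<psi> \<subseteq> pull_in \<phi> \<psi> ` comps \<psi>"
    proof
      fix x assume "x \<in> comps \<phi> <+> no_in \<psi>"
      then consider a where "a \<in> comps \<phi>" "x = Inl a" | b where "b \<in> no_in \<psi>" "x = Inr b" by blast
      then show "x \<in> pull_in \<phi> \<psi> ` comps \<psi>"
      proof cases
        case 1
        then obtain y where y: "y \<in> {1..src \<psi>}" "a = lout \<phi> y" using surj(1) by blast
        then have "x = pull_in \<phi> \<psi> (lin \<psi> y)" using pull_in_lin[OF inj y(1), where \<phi> = \<phi>] 1 by simp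
        then show ?thesis using cob_lin[OF cob] y(1) by simp
      next
        case 2
        then have "x = pull_in \<phi> \<psi> b" "b \<in> comps \<psi>" by (auto simp: no_in_def pull_in_def)
        then show ?thesis by blast
      qed
    qed
  qed
  moreover have "lout (absorb_second \<phi> \<psi>) ` {1..tgt \<psi>} = pull_in \<phi> \<psi> ` (lout \<psi> ` {1..tgt \<psi>})"
    by (simp only: image_image) (simp add: absorb_second_def)
  ultimately have "lout (absorb_second \<phi> \<psi>) ` {1..tgt \<psi>} = comps \<phi> <+> no_in \<psi>"
    using surj(2) by simp
  moreover have "inj_on (\<lambda>i. Inl (lin \<phi> i) :: 'a + 'b) {1..src \<phi>}"
    using \<phi> by (intro inj_onI) (auto simp: is_fibration_def dest: inj_onD)
  ultimately show ?thesis using \<phi> by (simp add: is_fibration_def absorb_second_def)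
qed

text \<open>The outer legs of the composite are those of \<open>\<phi>\<close> and \<open>\<psi>\<close> followed by the coprojections. If the
  result is injective, so were they. For a pair of inverse cobordisms, this makes all four legs
  injective and thus opens the way to \<open>absorb_first\<close>.\<close>

lemma inj_legs_if_comp_ident:
  assumes cob: "is_cob \<phi>" "is_cob \<psi>" "tgt \<phi> = src \<psi>"
    and id: "Cob_comp (cob_class \<psi>) (cob_class \<phi>) = Cob_ident n"
  shows "inj_on (lin \<phi>) {1..src \<phi>}" "inj_on (lout \<psi>) {1..tgt \<psi>}" "src \<phi> = n" "tgt \<psi> = n"
proof -
  have "is_cob (ident_cob n)" by (simp add: is_cob_def ident_cob_def)
  note c = comp_cob_comp_via[OF cob]
  have "cob_equiv (comp_cob \<psi> \<phi>) (ident_cob n)"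
    using id unfolding Cob_comp_class[OF c cob] Cob_ident_def
    using cob_class_eq_iff[OF comp_via_cob(1)[OF c] \<open>is_cob (ident_cob n)\<close>] by blast
  then obtain f where "comp_via \<phi> \<psi> f (ident_cob n)"
    using c presents_equiv unfolding comp_via_def by blast
  then interpret C: presents "src \<phi>" "tgt \<psi>" "comps \<phi> <+> comps \<psi>" "glue \<phi> \<psi>"
    "case_sum (\<lambda>a. int (genus \<phi> a) - 1) (\<lambda>b. int (genus \<psi> b) - 1)" "{1..tgt \<phi>}"
    "\<lambda>y. Inl (lout \<phi> y)" "\<lambda>i. Inl (lin \<phi> i)" "\<lambda>j. Inr (lout \<psi> j)" f "ident_cob n"
    by (simp only: comp_via_def)
  show "src \<phi> = n" "tgt \<psi> = n" using C.src C.tgt by (simp_all add: ident_cob_def)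
  have "f (Inl (lin \<phi> i)) = i" if "i \<in> {1..src \<phi>}" for i
    using C.lin[of i] that by (simp add: ident_cob_def)
  then show "inj_on (lin \<phi>) {1..src \<phi>}" by (metis inj_onI)
  have "f (Inr (lout \<psi> j)) = j" if "j \<in> {1..tgt \<psi>}" for j
    using C.lout[of j] that by (simp add: ident_cob_def)
  then show "inj_on (lout \<psi>) {1..tgt \<psi>}" by (metis inj_onI)
qed

text \<open>Every component of an identity has both an incoming and an outgoing circle and genus \<open>0\<close>. In
  \<open>absorb_first \<phi> \<psi>\<close>, the components \<open>Inl a\<close> have no outgoing circle, so there are none; a component
  \<open>Inr b\<close> has an incoming circle only through \<open>lin \<psi>\<close>; and its genus is at least the sum of the genera
  absorbed.\<close>

lemma absorb_first_ident:
  assumes cob: "is_cob \<phi>" "is_cob \<psi>" "tgt \<phi> = src \<psi>"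
    and id: "Cob_comp (cob_class \<psi>) (cob_class \<phi>) = Cob_ident n"
    and inj: "inj_on (lout \<phi>) {1..tgt \<phi>}"
  shows "no_out \<phi> = {}" "comps \<psi> \<subseteq> lin \<psi> ` {1..src \<psi>}" "\<forall>y\<in>{1..tgt \<phi>}. genus \<phi> (lout \<phi> y) = 0"
proof -
  let ?\<chi> = "absorb_first \<phi> \<psi>"
  have idc: "is_cob (ident_cob n)" by (simp add: is_cob_def ident_cob_def)
  have "cob_equiv ?\<chi> (ident_cob n)"
    using id Cob_comp_absorb_first(2)[OF cob inj]
      cob_class_eq_iff[OF Cob_comp_absorb_first(1)[OF cob inj] idc] by (simp add: Cob_ident_def)
  then obtain \<theta> where "cob_iso \<theta> ?\<chi> (ident_cob n)" by (auto simp: cob_equiv_iff_iso)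
  note \<theta> = cob_isoD[OF this]
  have legs: "lin ?\<chi> i \<in> comps ?\<chi>" "lout ?\<chi> i \<in> comps ?\<chi>" if "i \<in> {1..n}" for i
    using Cob_comp_absorb_first(1)[OF cob inj] \<theta>(1,2) that
    by (auto simp: ident_cob_def intro: cob_lin cob_lout)
  have hit: "\<exists>i\<in>{1..n}. c = lin ?\<chi> i \<and> c = lout ?\<chi> i" if c: "c \<in> comps ?\<chi>" for c
  proof -
    have n: "\<theta> c \<in> {1..n}" using \<theta>(4) c by (auto simp: ident_cob_def)
    then have "\<theta> (lin ?\<chi> (\<theta> c)) = \<theta> c" "\<theta> (lout ?\<chi> (\<theta> c)) = \<theta> c"
      using \<theta>(1,2) \<theta>(5)[of "\<theta> c"] \<theta>(6)[of "\<theta> c"] by (simp_all add: ident_cob_def)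
    then show ?thesis using legs[OF n] c \<theta>(3) n by (metis inj_onD)
  qed
  show "no_out \<phi> = {}"
  proof (rule ccontr)
    assume "no_out \<phi> \<noteq> {}"
    then obtain a where "Inl a \<in> comps ?\<chi>" by (auto simp: absorb_first_def)
    then show False using hit by (force simp: absorb_first_def)
  qed
  show "comps \<psi> \<subseteq> lin \<psi> ` {1..src \<psi>}"
  proof
    fix b assume "b \<in> comps \<psi>"
    then have "Inr b \<in> comps ?\<chi>" by (simp add: absorb_first_def InrI)
    then obtain i where i: "i \<in> {1..src \<phi>}" "Inr b = push_out \<phi> \<psi> (lin \<phi> i)"
      using hit \<theta>(1) by (force simp: absorb_first_def ident_cob_def)
    have "lin \<phi> i \<in> comps \<phi>" using cob_lin[OF cob(1)] i by simp
    from inj this show "b \<in> lin \<psi> ` {1..src \<psi>}"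
      by (rule push_out_cases[where \<psi> = \<psi>]) (use i cob(3) in auto)
  qed
  show "\<forall>y\<in>{1..tgt \<phi>}. genus \<phi> (lout \<phi> y) = 0"
  proof
    fix y assume y: "y \<in> {1..tgt \<phi>}"
    then have "Inr (lin \<psi> y) \<in> comps ?\<chi>"
      using cob_lin[OF cob(2)] cob(3) by (simp add: absorb_first_def InrI)
    from \<theta>(7)[OF this] have "(\<Sum>z\<in>{z\<in>{1..tgt \<phi>}. lin \<psi> z = lin \<psi> y}. genus \<phi> (lout \<phi> z)) = 0"
      by (simp add: absorb_first_def ident_cob_def)
    then show "genus \<phi> (lout \<phi> y) = 0" using y by simp
  qed
qed

text \<open>An isomorphism is a permutation of circles: both legs are bijections onto the components, and the
  genus vanishes.\<close>

lemma isomorphism_is_cofibration_and_fibration: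
  assumes cob: "is_cob \<phi>" "is_cob \<psi>" and st: "tgt \<phi> = src \<psi>" "tgt \<psi> = src \<phi>"
    and id: "Cob_comp (cob_class \<psi>) (cob_class \<phi>) = Cob_ident (src \<phi>)"
      "Cob_comp (cob_class \<phi>) (cob_class \<psi>) = Cob_ident (tgt \<phi>)"
  shows "is_cofibration \<phi>" "is_fibration \<phi>"
proof -
  note a = inj_legs_if_comp_ident[OF cob st(1) id(1)]
  note b = inj_legs_if_comp_ident[OF cob(2,1) st(2) id(2)]
  note c = absorb_first_ident[OF cob st(1) id(1) b(2)]
  note d = absorb_first_ident[OF cob(2,1) st(2) id(2) a(2)]
  have out: "lout \<phi> ` {1..tgt \<phi>} = comps \<phi>"
    using c(1) cob_lout[OF cob(1)] by (auto simp: no_out_def)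
  have "\<forall>j\<in>{1..tgt \<phi>}. \<exists>i. i \<in> {1..src \<phi>} \<and> lout \<phi> j = lin \<phi> i"
    using d(2) out by blast
  then obtain u where "\<forall>j\<in>{1..tgt \<phi>}. u j \<in> {1..src \<phi>} \<and> lout \<phi> j = lin \<phi> (u j)" by metis
  then show "is_cofibration \<phi>" using b(2) unfolding is_cofibration_def by blast
  have "genus \<phi> x = 0" if "x \<in> comps \<phi>" for x using that c(3) out by (metis imageE)
  then show "is_fibration \<phi>" using a(1) out cob_lin[OF cob(1)] by (simp add: is_fibration_def)
qed

section \<open>Factorization\<close>

lemma pull_in_no_in: "b \<in> no_in \<psi> \<Longrightarrow> pull_in \<phi> \<psi> b = Inr b"
  by (simp add: no_in_def pull_in_def)

text \<open>\<open>I\<close> is the set of components with incoming and outgoing circles. Both factors contain it, and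
  the circles of the middle object number its elements.\<close>

lemma factorization_exists:
  fixes \<phi> :: "'a cob"
  assumes \<phi>: "is_cob \<phi>"
  obtains e r :: "'a cob" where "is_cob e" "is_cob r" "src e = src \<phi>" "tgt e = src r" "tgt r = tgt \<phi>"
    "is_cofibration e" "is_fibration r" "cob_equiv (absorb_second e r) \<phi>"
proof -
  let ?X = "{1..src \<phi>}" and ?Y = "{1..tgt \<phi>}"
  define I where "I = lin \<phi> ` ?X \<inter> lout \<phi> ` ?Y"
  define k where "k = card I"
  have "finite I" by (simp add: I_def)
  then obtain h where "bij_betw h {1..k} I" unfolding k_def using ex_bij_betw_nat_finite_1 by blast
  then have h: "inj_on h {1..k}" "h ` {1..k} = I" by (auto simp: bij_betw_def)
  have legs: "lin \<phi> ` ?X \<subseteq> comps \<phi>" "lout \<phi> ` ?Y \<subseteq> comps \<phi>"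
    using \<phi> by (auto simp: cob_lin cob_lout)
  define e where "e = \<lparr>src = src \<phi>, tgt = k, comps = comps \<phi> - (lout \<phi> ` ?Y - lin \<phi> ` ?X),
    lin = lin \<phi>, lout = h, genus = genus \<phi>\<rparr>"
  define r where "r = \<lparr>src = k, tgt = tgt \<phi>, comps = lout \<phi> ` ?Y,
    lin = h, lout = lout \<phi>, genus = (\<lambda>c. if c \<in> I then 0 else genus \<phi> c)\<rparr>"
  have hI: "h y \<in> I" if "y \<in> {1..k}" for y using that h(2) by blast
  have "I \<subseteq> comps \<phi> - (lout \<phi> ` ?Y - lin \<phi> ` ?X)" "I \<subseteq> lout \<phi> ` ?Y"
    using legs by (auto simp: I_def)
  then have hc: "h y \<in> comps e" "h y \<in> comps r" if "y \<in> {1..k}" for y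
    using hI[OF that] by (auto simp: e_def r_def)
  have e_sel: "src e = src \<phi>" "tgt e = k" "lin e = lin \<phi>" "lout e = h" "finite (comps e)"
    using cob_finite[OF \<phi>] by (simp_all add: e_def)
  have r_sel: "src r = k" "tgt r = tgt \<phi>" "lin r = h" "lout r = lout \<phi>" "finite (comps r)"
    by (simp_all add: r_def)
  have "lin \<phi> i \<in> comps e" if "i \<in> ?X" for i using that legs by (auto simp: e_def)
  then have e: "is_cob e" using hc(1) by (auto simp: is_cob_def e_sel)
  have "lout \<phi> j \<in> comps r" if "j \<in> ?Y" for j using that by (auto simp: r_def)
  then have r: "is_cob r" using hc(2) by (auto simp: is_cob_def r_sel)
  have "\<forall>y\<in>{1..k}. \<exists>i. i \<in> ?X \<and> h y = lin \<phi> i" using hI unfolding I_def by blast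
  then obtain i where "\<forall>y\<in>{1..k}. i y \<in> ?X \<and> h y = lin \<phi> (i y)" by metis
  then have cof: "is_cofibration e"
    using h(1) by (auto simp: is_cofibration_def e_def intro!: exI[of _ i])
  have fib: "is_fibration r"
    using h(1) hI by (auto simp: is_fibration_def r_def)
  have no_in: "no_in r = lout \<phi> ` ?Y - I" using h(2) by (simp add: no_in_def r_def)
  have hr: "inj_on (lin r) {1..src r}" using fib by (simp add: is_fibration_def)
  have "cob_equiv (absorb_second e r) \<phi>"
  proof (rule cob_equivI[where \<theta> = "case_sum id id"])
    have dom: "comps (absorb_second e r) = comps e <+> no_in r" by (simp add: absorb_second_def)
    \<comment> \<open>\<open>N\<close> and \<open>O'\<close>: the components with an incoming and with an outgoing circle; the two factors
      overlap in \<open>I\<close> only, so dropping \<open>I\<close> from the second gives a partition\<close>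
    define N O' where "N = lin \<phi> ` ?X" and "O' = lout \<phi> ` ?Y"
    have sets: "comps e = comps \<phi> - (O' - N)" "no_in r = O' - N"
      unfolding no_in I_def by (auto simp: e_def N_def O'_def)
    show "inj_on (case_sum id id) (comps (absorb_second e r))"
      unfolding dom sets by (rule inj_onI) auto
    show "case_sum id id ` comps (absorb_second e r) = comps \<phi>"
    proof -
      have "case_sum id id ` (comps e <+> no_in r) = comps e \<union> no_in r"
        by (simp add: Plus_def image_Un image_image)
      also have "\<dots> = comps \<phi>" unfolding sets using legs(2) by (auto simp: O'_def)
      finally show ?thesis unfolding dom .
    qed
    show "case_sum id id (lout (absorb_second e r) j) = lout \<phi> j"
      if "j \<in> {1..tgt (absorb_second e r)}" for j
    proof -
      have "lout r j \<in> comps r" using that by (auto simp: absorb_second_def r_def)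
      from hr this have "case_sum id id (pull_in e r (lout r j)) = lout r j"
        by (rule pull_in_cases[where \<phi> = e]) (auto simp: e_def r_def)
      then show ?thesis by (simp add: absorb_second_def r_def)
    qed
    show "genus \<phi> (case_sum id id c) = genus (absorb_second e r) c"
      if "c \<in> comps (absorb_second e r)" for c
      using that unfolding dom no_in by (auto simp: absorb_second_def e_def r_def)
  qed (simp_all add: absorb_second_def e_def r_def)
  then show thesis using that[OF e r _ _ _ cof fib] by (simp add: e_def r_def)
qed

section \<open>Orthogonality\<close>

text \<open>Fibrations are monomorphisms. The components \<open>Inr d\<close> of the two composites are recognized by
  their outgoing circles, so the given bijection fixes them and restricts to the remaining components,
  which are those of \<open>w\<close> and \<open>w'\<close>. The outgoing leg of \<open>w\<close> is visible in the composite because every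
  component \<open>lin r y\<close> has an outgoing circle.\<close>

lemma fibration_left_cancel:
  assumes cob: "is_cob w" "is_cob w'" "tgt w = src r" "tgt w' = src r"
    and r: "is_cob r" "is_fibration r"
    and eq: "cob_equiv (absorb_second w r) (absorb_second w' r)"
  shows "cob_equiv w w'"
proof -
  have inj: "inj_on (lin r) {1..src r}" and surj: "lout r ` {1..tgt r} = comps r"
    using r(2) by (simp_all add: is_fibration_def)
  let ?\<chi> = "absorb_second w r" and ?\<chi>' = "absorb_second w' r"
  from eq obtain \<theta> where "cob_iso \<theta> ?\<chi> ?\<chi>'" by (auto simp: cob_equiv_iff_iso)
  note \<theta>' = cob_isoD[OF this]
  note st = \<theta>'(1)[unfolded absorb_second_sel] and \<theta> = \<theta>'(3,4)[unfolded absorb_second_sel]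
    and lin = \<theta>'(5)[unfolded absorb_second_sel] and lout = \<theta>'(6)[unfolded absorb_second_sel]
    and genus = \<theta>'(7)[unfolded absorb_second_sel]
  have pull: "\<theta> (pull_in w r d) = pull_in w' r d" if "d \<in> comps r" for d
  proof -
    have "d \<in> lout r ` {1..tgt r}" using that by (simp only: surj)
    then obtain j where j: "d = lout r j" "j \<in> {1..tgt r}" by (rule imageE)
    show ?thesis unfolding j(1) by (rule lout[OF j(2)])
  qed
  have fix_in: "\<theta> (Inr d) = Inr d" if "d \<in> no_in r" for d
    using pull[of d] that by (simp add: pull_in_no_in) (simp add: no_in_def)
  have ex: "\<exists>c'. c' \<in> comps w' \<and> \<theta> (Inl c) = Inl c'" if c: "c \<in> comps w" for c
  proof -
    have "\<theta> (Inl c) \<in> comps w' <+> no_in r" using c \<theta>(2) by blast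
    moreover have "\<theta> (Inl c) \<noteq> Inr d" if "d \<in> no_in r" for d
      using fix_in[OF that] inj_onD[OF \<theta>(1), of "Inl c" "Inr d"] c that by auto
    ultimately show ?thesis by blast
  qed
  then obtain \<eta> where \<eta>: "\<And>c. c \<in> comps w \<Longrightarrow> \<eta> c \<in> comps w' \<and> \<theta> (Inl c) = Inl (\<eta> c)" by metis
  show ?thesis
  proof (rule cob_equivI[where \<theta> = \<eta>])
    show "src w = src w'" "tgt w = tgt w'" using st cob by simp_all
    show "inj_on \<eta> (comps w)"
    proof (rule inj_onI)
      fix c d assume "c \<in> comps w" "d \<in> comps w" "\<eta> c = \<eta> d"
      then show "c = d" using \<eta> inj_onD[OF \<theta>(1), of "Inl c" "Inl d"] by (simp add: InlI)
    qed
    show "\<eta> ` comps w = comps w'"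
    proof
      show "comps w' \<subseteq> \<eta> ` comps w"
      proof
        fix c' assume "c' \<in> comps w'"
        then have "Inl c' \<in> \<theta> ` (comps w <+> no_in r)" by (simp only: \<theta>(2) InlI)
        then obtain p where "p \<in> comps w <+> no_in r" "\<theta> p = Inl c'" by (metis imageE)
        then show "c' \<in> \<eta> ` comps w" using \<eta> fix_in by auto
      qed
    qed (use \<eta> in blast)
    show "\<eta> (lin w i) = lin w' i" if "i \<in> {1..src w}" for i
      using lin[OF that] \<eta> cob_lin[OF cob(1)] that by simp
    show "\<eta> (lout w y) = lout w' y" if y: "y \<in> {1..tgt w}" for y
    proof -
      have y': "y \<in> {1..src r}" using y cob by simp
      have "\<theta> (Inl (lout w y)) = Inl (lout w' y)"
        using pull[of "lin r y"] cob_lin[OF r(1)] y' pull_in_lin[OF inj y', where \<phi> = w]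
          pull_in_lin[OF inj y', where \<phi> = w'] by simp
      then show ?thesis using \<eta> cob_lout[OF cob(1)] y by simp
    qed
    show "genus w' (\<eta> c) = genus w c" if "c \<in> comps w" for c
      using genus[of "Inl c"] \<eta>[OF that] that by (simp add: InlI)
  qed
qed

text \<open>The diagonal \<open>w\<close> is the part of \<open>v\<close> that \<open>\<theta>\<close> matches with components of \<open>u\<close>. It contains the
  image of \<open>lin v\<close>, since on the cofibration \<open>e\<close> every outgoing circle \<open>y\<close> shares its component
  with an incoming circle \<open>x y\<close>, which \<open>\<theta>\<close> traces into \<open>u\<close>. It contains the components needed for
  its outgoing leg, since every component \<open>lin r y\<close> of the fibration \<open>r\<close> has an outgoing circle.\<close>

lemma diagonal_exists:
  fixes e :: "'a cob" and v :: "'b cob" and u :: "'c cob" and r :: "'d cob"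
  assumes cob: "is_cob e" "is_cob v" "is_cob u" "is_cob r" "tgt e = src v" "tgt u = src r"
    and e: "is_cofibration e" and r: "is_fibration r"
    and eq: "cob_equiv (absorb_first e v) (absorb_second u r)"
  obtains w :: "'b cob" where "is_cob w" "src w = tgt e" "tgt w = src r"
    "cob_equiv (absorb_first e w) u" "cob_equiv (absorb_second w r) v"
proof -
  have inj_e: "inj_on (lout e) {1..tgt e}" using e by (simp add: is_cofibration_def)
  obtain x where "x \<in> {1..tgt e} \<rightarrow> {1..src e}" "\<forall>y\<in>{1..tgt e}. lout e y = lin e (x y)"
    using e unfolding is_cofibration_def by blast
  then have x: "x y \<in> {1..src e} \<and> lout e y = lin e (x y)" if "y \<in> {1..tgt e}" for y
    using that by blast
  have inj_r: "inj_on (lin r) {1..src r}" and surj: "lout r ` {1..tgt r} = comps r"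
    using r by (simp_all add: is_fibration_def)
  define S where "S b = (\<Sum>y\<in>{y\<in>{1..tgt e}. lin v y = b}. genus e (lout e y))" for b
  let ?\<chi> = "absorb_first e v" and ?\<chi>' = "absorb_second u r"
  from eq obtain \<theta> where "cob_iso \<theta> ?\<chi> ?\<chi>'" by (auto simp: cob_equiv_iff_iso)
  note \<theta>' = cob_isoD[OF this]
  note sel = absorb_first_sel absorb_second_sel S_def[symmetric]
  note st = \<theta>'(1,2)[unfolded sel] and \<theta> = \<theta>'(3,4)[unfolded sel] and lin = \<theta>'(5)[unfolded sel]
    and lout = \<theta>'(6)[unfolded sel] and genus = \<theta>'(7)[unfolded sel]
  have lout_v: "lout v j \<in> comps v" if "j \<in> {1..tgt v}" for j
    using cob_lout[OF cob(2)] that by simp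
  have reach: "\<exists>j\<in>{1..tgt v}. lout r j = d" if "d \<in> comps r" for d
    using that surj st(2) by (metis imageE)
  have no_in_hit: "\<exists>b\<in>comps v. \<theta> (Inr b) = Inr d" if d: "d \<in> no_in r" for d
  proof -
    have "d \<in> comps r" using d by (simp add: no_in_def)
    then obtain j where j: "j \<in> {1..tgt v}" "lout r j = d" using reach by blast
    then have "\<theta> (Inr (lout v j)) = Inr d"
      using lout[OF j(1)] pull_in_no_in[OF d, where \<phi> = u] by simp
    then show ?thesis using lout_v[OF j(1)] by blast
  qed
  have \<theta>_no_out: "\<exists>c\<in>comps u. \<theta> (Inl a) = Inl c" if a: "a \<in> no_out e" for a
  proof -
    have "\<theta> (Inl a) \<in> comps u <+> no_in r" using a \<theta>(2) by blast
    moreover have "\<theta> (Inl a) \<noteq> Inr d" if d: "d \<in> no_in r" for d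
    proof
      assume "\<theta> (Inl a) = Inr d"
      moreover obtain b where b: "b \<in> comps v" "\<theta> (Inr b) = Inr d" using no_in_hit[OF d] by blast
      ultimately have "\<theta> (Inl a) = \<theta> (Inr b)" by simp
      from inj_onD[OF \<theta>(1) this] show False using a b(1) by auto
    qed
    ultimately show ?thesis by blast
  qed
  define W where "W = {b\<in>comps v. \<exists>c\<in>comps u. \<theta> (Inr b) = Inl c}"
  have lin_W: "lin v y \<in> W" if y: "y \<in> {1..tgt e}" for y
  proof -
    have "\<theta> (Inr (lin v y)) = Inl (lin u (x y))"
      using lin[of "x y"] x[OF y] push_out_lout[OF inj_e y, where \<psi> = v] by simp
    then show ?thesis using x[OF y] y cob st(1) by (auto simp: W_def cob_lin)
  qed
  \<comment> \<open>the outgoing leg of the diagonal, read off from the outgoing circles of \<open>r\<close>\<close>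
  have "\<exists>b. b \<in> W \<and> \<theta> (Inr b) = Inl (lout u y)" if y: "y \<in> {1..src r}" for y
  proof -
    obtain j where j: "j \<in> {1..tgt v}" "lout r j = lin r y"
      using reach[of "lin r y"] cob_lin[OF cob(4)] y by auto
    then have "\<theta> (Inr (lout v j)) = Inl (lout u y)"
      using lout[OF j(1)] pull_in_lin[OF inj_r y, where \<phi> = u] by simp
    then show ?thesis using lout_v[OF j(1)] cob_lout[OF cob(3)] y cob(6) by (auto simp: W_def)
  qed
  then obtain out where out: "\<And>y. y \<in> {1..src r} \<Longrightarrow> out y \<in> W \<and> \<theta> (Inr (out y)) = Inl (lout u y)"
    by metis
  define w where "w = \<lparr>src = tgt e, tgt = src r, comps = W, lin = lin v, lout = out, genus = genus v\<rparr>"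
  have w_simps: "src w = tgt e" "tgt w = src r" "comps w = W" "lin w = lin v" "lout w = out" "genus w = genus v"
    by (simp_all add: w_def)
  have Wv: "W \<subseteq> comps v" by (auto simp: W_def)
  have w: "is_cob w"
    using finite_subset[OF Wv cob_finite[OF cob(2)]] lin_W out by (auto simp: is_cob_def w_simps)
  have \<theta>_W: "\<exists>c\<in>comps u. \<theta> p = Inl c" if "p \<in> no_out e <+> W" for p
    using that \<theta>_no_out by (auto simp: W_def)
  have push: "push_out e w a = push_out e v a" for a by (simp add: push_out_def w_simps)
  have eq_u: "cob_equiv (absorb_first e w) u"
  proof (rule cob_equivI[where \<theta> = "projl \<circ> \<theta>"])
    have dom: "comps (absorb_first e w) = no_out e <+> W" by (simp add: absorb_first_def w_simps)
    have sub: "no_out e <+> W \<subseteq> no_out e <+> comps v" using Wv by auto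
    have \<theta>l: "\<theta> p = Inl (projl (\<theta> p)) \<and> projl (\<theta> p) \<in> comps u" if "p \<in> no_out e <+> W" for p
      using \<theta>_W[OF that] by auto
    show "src (absorb_first e w) = src u" "tgt (absorb_first e w) = tgt u"
      using st(1) cob(6) by (simp_all add: absorb_first_def w_simps)
    show "inj_on (projl \<circ> \<theta>) (comps (absorb_first e w))"
      unfolding dom
    proof (rule inj_onI)
      fix p q assume pq: "p \<in> no_out e <+> W" "q \<in> no_out e <+> W" "(projl \<circ> \<theta>) p = (projl \<circ> \<theta>) q"
      then have "\<theta> p = \<theta> q" using \<theta>l by (metis comp_apply)
      then show "p = q" using inj_onD[OF \<theta>(1)] pq sub by blast
    qed
    show "(projl \<circ> \<theta>) ` comps (absorb_first e w) = comps u"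
      unfolding dom
    proof
      show "(projl \<circ> \<theta>) ` (no_out e <+> W) \<subseteq> comps u" using \<theta>l by auto
      show "comps u \<subseteq> (projl \<circ> \<theta>) ` (no_out e <+> W)"
      proof
        fix c assume c: "c \<in> comps u"
        then have "Inl c \<in> \<theta> ` (no_out e <+> comps v)" by (simp only: \<theta>(2) InlI)
        then obtain p where p: "p \<in> no_out e <+> comps v" "\<theta> p = Inl c" by (metis imageE)
        then have "p \<in> no_out e <+> W" using c by (auto simp: W_def)
        then show "c \<in> (projl \<circ> \<theta>) ` (no_out e <+> W)" using p(2) by (metis comp_apply image_eqI sum.sel(1))
      qed
    qed
    show "(projl \<circ> \<theta>) (lin (absorb_first e w) i) = lin u i" if "i \<in> {1..src (absorb_first e w)}" for i
      using that lin[of i] by (simp add: absorb_first_def push)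
    show "(projl \<circ> \<theta>) (lout (absorb_first e w) y) = lout u y" if "y \<in> {1..tgt (absorb_first e w)}" for y
      using that out[of y] by (simp add: absorb_first_def w_simps)
    show "genus u ((projl \<circ> \<theta>) p) = genus (absorb_first e w) p" if "p \<in> comps (absorb_first e w)" for p
    proof -
      have p: "p \<in> no_out e <+> W" using that by (simp only: dom)
      obtain c where c: "\<theta> p = Inl c" using \<theta>l[OF p] by blast
      have "genus u (projl (\<theta> p)) = case_sum (genus e) (\<lambda>b. genus v b + S b) p"
        using genus[OF subsetD[OF sub p]] by (simp only: c sum.case sum.sel)
      then show ?thesis by (simp only: sel w_simps comp_apply)
    qed
  qed
  have eq_v: "cob_equiv v (absorb_second w r)"
  proof -
    \<comment> \<open>components of \<open>v\<close> that go to \<open>u\<close> under \<open>\<theta>\<close> are kept, the others are those of \<open>r\<close>\<close>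
    define \<eta> where "\<eta> b = case_sum (\<lambda>_. Inl b) Inr (\<theta> (Inr b))" for b
    have \<eta>: "\<eta> b = Inl b \<and> b \<in> W \<or> (\<exists>d\<in>no_in r. \<eta> b = Inr d \<and> \<theta> (Inr b) = Inr d)"
      if b: "b \<in> comps v" for b
    proof -
      have "\<theta> (Inr b) \<in> comps u <+> no_in r" using b \<theta>(2) by blast
      then show ?thesis using b by (auto simp: \<eta>_def W_def)
    qed
    have \<eta>_W: "\<eta> b = Inl b" if "b \<in> W" for b using that by (auto simp: \<eta>_def W_def)
    have inj_v: "b = b'" if "b \<in> comps v" "b' \<in> comps v" "\<theta> (Inr b) = \<theta> (Inr b')" for b b'
      using inj_onD[OF \<theta>(1) that(3)] that by (simp add: InrI)
    have dom: "comps (absorb_second w r) = W <+> no_in r" by (simp add: absorb_second_def w_simps)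
    show ?thesis
    proof (rule cob_equivI[where \<theta> = \<eta>])
      show "src v = src (absorb_second w r)" "tgt v = tgt (absorb_second w r)"
        using cob st by (simp_all add: absorb_second_def w_simps)
      show "inj_on \<eta> (comps v)"
      proof (rule inj_onI)
        fix b b' assume "b \<in> comps v" "b' \<in> comps v" "\<eta> b = \<eta> b'"
        then show "b = b'" using \<eta>[of b] \<eta>[of b'] inj_v[of b b'] by auto
      qed
      show "\<eta> ` comps v = comps (absorb_second w r)"
        unfolding dom
      proof
        show "\<eta> ` comps v \<subseteq> W <+> no_in r" using \<eta> by fastforce
        show "W <+> no_in r \<subseteq> \<eta> ` comps v"
        proof
          fix p assume "p \<in> W <+> no_in r"
          then show "p \<in> \<eta> ` comps v"
          proof (elim PlusE)
            fix b assume "b \<in> W" "p = Inl b"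
            then show ?thesis using \<eta>_W Wv by force
          next
            fix d assume d: "d \<in> no_in r" "p = Inr d"
            then obtain b where "b \<in> comps v" "\<theta> (Inr b) = Inr d" using no_in_hit by blast
            then show ?thesis using d by (force simp: \<eta>_def)
          qed
        qed
      qed
      show "\<eta> (lin v y) = lin (absorb_second w r) y" if "y \<in> {1..src v}" for y
        using that lin_W[of y] cob(5) by (simp add: absorb_second_def w_simps \<eta>_W)
      show "\<eta> (lout v j) = lout (absorb_second w r) j" if j: "j \<in> {1..tgt v}" for j
      proof -
        have "lout r j \<in> comps r" using j st(2) cob_lout[OF cob(4)] by simp
        from inj_r this have "\<eta> (lout v j) = pull_in w r (lout r j)"
        proof (rule pull_in_cases[where \<phi> = u])
          fix y assume y: "y \<in> {1..src r}" "lout r j = lin r y" "pull_in u r (lout r j) = Inl (lout u y)"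
          have "lout v j = out y"
            using inj_v[OF lout_v[OF j], of "out y"] lout[OF j] y(3) out[OF y(1)] Wv by auto
          then show ?thesis
            using out[OF y(1)] y(2) pull_in_lin[OF inj_r y(1), where \<phi> = w] by (simp add: \<eta>_W w_simps)
        next
          assume "lout r j \<in> no_in r" "pull_in u r (lout r j) = Inr (lout r j)"
          then show ?thesis using lout[OF j] by (simp add: \<eta>_def pull_in_no_in)
        qed
        then show ?thesis by (simp add: absorb_second_def)
      qed
      show "genus (absorb_second w r) (\<eta> b) = genus v b" if b: "b \<in> comps v" for b
        using \<eta>[OF b]
      proof (elim disjE bexE conjE)
        assume "\<eta> b = Inl b"
        then show ?thesis by (simp add: absorb_second_def w_simps)
      next
        fix d assume d: "\<eta> b = Inr d" "\<theta> (Inr b) = Inr d"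
        have "b \<notin> W" using d(1) \<eta>_W by auto
        then have "{y\<in>{1..tgt e}. lin v y = b} = {}" using lin_W by blast
        \<comment> \<open>no component of \<open>e\<close> is absorbed by \<open>b\<close>, so \<open>b\<close> has the same genus in \<open>v\<close> and in the composite\<close>
        then have "S b = 0" unfolding S_def by (simp only: sum.empty)
        then show ?thesis using genus[of "Inr b"] d b by (simp add: absorb_second_def InrI)
      qed
    qed
  qed
  show thesis by (rule that[OF w w_simps(1,2) eq_u cob_equiv_sym[OF eq_v cob(2)]])
qed

lemma isomorphism_classes:
  assumes "\<Phi> \<in> category.isomorphisms (UNIV :: nat set) Cob_hom Cob_comp Cob_ident"
  shows "\<Phi> \<in> cofibrations" "\<Phi> \<in> fibrations"
proof -
  obtain m n \<Psi> where \<Phi>: "\<Phi> \<in> Cob_hom m n" and \<Psi>: "\<Psi> \<in> Cob_hom n m"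
    and id: "Cob_comp \<Psi> \<Phi> = Cob_ident m" "Cob_comp \<Phi> \<Psi> = Cob_ident n"
    using assms unfolding category.isomorphisms_def[OF category_Cob] by blast
  obtain \<phi> :: "nat cob" where \<phi>: "\<Phi> = cob_class \<phi>" "is_cob \<phi>" "src \<phi> = m" "tgt \<phi> = n"
    using \<Phi> by (rule Cob_homE)
  obtain \<psi> :: "nat cob" where \<psi>: "\<Psi> = cob_class \<psi>" "is_cob \<psi>" "src \<psi> = n" "tgt \<psi> = m"
    using \<Psi> by (rule Cob_homE)
  have "is_cofibration \<phi>" "is_fibration \<phi>"
    using isomorphism_is_cofibration_and_fibration[OF \<phi>(2) \<psi>(2)] \<phi> \<psi> id by simp_all
  then show "\<Phi> \<in> cofibrations" "\<Phi> \<in> fibrations"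
    using \<phi>(1,2) by (simp_all add: cob_class_cofibrations cob_class_fibrations)
qed

lemma Cob_orthogonality:
  assumes hom: "E \<in> Cob_hom m n" "R \<in> Cob_hom m' n'" "U \<in> Cob_hom m m'" "V \<in> Cob_hom n n'"
    and E: "E \<in> cofibrations" and R: "R \<in> fibrations" and square: "Cob_comp V E = Cob_comp R U"
  shows "\<exists>!W. W \<in> Cob_hom n m' \<and> Cob_comp W E = U \<and> Cob_comp R W = V"
proof -
  obtain e :: "nat cob" where e: "E = cob_class e" "is_cob e" "src e = m" "tgt e = n"
    using hom(1) by (rule Cob_homE)
  obtain r :: "nat cob" where r: "R = cob_class r" "is_cob r" "src r = m'" "tgt r = n'"
    using hom(2) by (rule Cob_homE)
  obtain u :: "nat cob" where u: "U = cob_class u" "is_cob u" "src u = m" "tgt u = m'"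
    using hom(3) by (rule Cob_homE)
  obtain v :: "nat cob" where v: "V = cob_class v" "is_cob v" "src v = n" "tgt v = n'"
    using hom(4) by (rule Cob_homE)
  have cof: "is_cofibration e" using E e by (simp add: cob_class_cofibrations)
  then have inj: "inj_on (lout e) {1..tgt e}" by (simp add: is_cofibration_def)
  have fib: "is_fibration r" using R r by (simp add: cob_class_fibrations)
  have ends: "tgt e = src v" "tgt u = src r" using e r u v by simp_all
  note ev = Cob_comp_absorb_first[OF e(2) v(2) ends(1) inj]
  note ur = Cob_comp_absorb_second[OF u(2) r(2) ends(2) fib]
  have "cob_equiv (absorb_first e v) (absorb_second u r)"
    using square ev(2) ur(2) cob_class_eq_iff[OF ev(1) ur(1)] by (simp add: e(1) r(1) u(1) v(1))
  then obtain w :: "nat cob" where w: "is_cob w" "src w = tgt e" "tgt w = src r"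
    and we: "cob_equiv (absorb_first e w) u" and rw: "cob_equiv (absorb_second w r) v"
    using diagonal_exists[OF e(2) v(2) u(2) r(2) ends cof fib] by metis
  note ew' = Cob_comp_absorb_first[OF e(2) w(1) w(2)[symmetric] inj]
  note wr' = Cob_comp_absorb_second[OF w(1) r(2) w(3) fib]
  show ?thesis
  proof (rule ex1I[of _ "cob_class w"], intro conjI)
    show "cob_class w \<in> Cob_hom n m'" using Cob_hom_class[OF w(1)] w e r by simp
    show "Cob_comp (cob_class w) E = U"
      unfolding e(1) u(1) ew'(2) by (rule cob_class_eqI[OF ew'(1) we])
    show "Cob_comp R (cob_class w) = V"
      unfolding r(1) v(1) wr'(2) by (rule cob_class_eqI[OF wr'(1) rw])
    fix W assume W: "W \<in> Cob_hom n m' \<and> Cob_comp W E = U \<and> Cob_comp R W = V"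
    then have "W \<in> Cob_hom n m'" by simp
    then obtain w' :: "nat cob" where w': "W = cob_class w'" "is_cob w'" "src w' = n" "tgt w' = m'"
      by (rule Cob_homE)
    then have t': "tgt w' = src r" using r by simp
    note wr = Cob_comp_absorb_second[OF w'(2) r(2) t' fib]
    have "cob_class (absorb_second w' r) = cob_class v"
      using W wr(2) by (simp add: w'(1) r(1) v(1))
    also have "\<dots> = cob_class (absorb_second w r)"
      by (rule cob_class_eqI[OF wr'(1) rw, symmetric])
    finally have "cob_equiv (absorb_second w' r) (absorb_second w r)"
      using cob_class_eq_iff[OF wr(1) wr'(1)] by simp
    then have "cob_equiv w' w" by (rule fibration_left_cancel[OF w'(2) w(1) t' w(3) r(2) fib])
    then show "W = cob_class w" unfolding w'(1) by (rule cob_class_eqI[OF w'(2)])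
  qed
qed

theorem theorem4p5:
  shows "orthogonal_factorization_system (UNIV :: nat set) Cob_hom Cob_comp Cob_ident
           cofibrations fibrations"
proof (intro orthogonal_factorization_system.intro orthogonal_factorization_system_axioms.intro category_Cob)
  let ?arrows = "category.arrows (UNIV :: nat set) Cob_hom"
  let ?isos = "category.isomorphisms (UNIV :: nat set) Cob_hom Cob_comp Cob_ident"
  show "cofibrations \<subseteq> ?arrows" "fibrations \<subseteq> ?arrows"
    by (auto simp: cofibrations_def fibrations_def category.arrows_def[OF category_Cob])
  show "?isos \<subseteq> cofibrations" "?isos \<subseteq> fibrations"
    using isomorphism_classes by blast+
next
  fix l m n \<Phi> \<Psi> assume "\<Phi> \<in> Cob_hom l m" "\<Psi> \<in> Cob_hom m n"
  then obtain \<phi> \<psi> :: "nat cob" where \<phi>: "\<Phi> = cob_class \<phi>" "is_cob \<phi>"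
    and \<psi>: "\<Psi> = cob_class \<psi>" "is_cob \<psi>" and eq: "tgt \<phi> = src \<psi>"
    by (elim Cob_homE) simp
  show "Cob_comp \<Psi> \<Phi> \<in> cofibrations" if "\<Phi> \<in> cofibrations" "\<Psi> \<in> cofibrations"
  proof -
    have cof: "is_cofibration \<phi>" "is_cofibration \<psi>"
      using that \<phi> \<psi> by (simp_all add: cob_class_cofibrations)
    then have "inj_on (lout \<phi>) {1..tgt \<phi>}" by (simp add: is_cofibration_def)
    note comp = Cob_comp_absorb_first[OF \<phi>(2) \<psi>(2) eq this]
    show ?thesis
      using is_cofibration_absorb_first[OF cof eq] comp \<phi>(1) \<psi>(1) by (simp add: cob_class_cofibrations)
  qed
  show "Cob_comp \<Psi> \<Phi> \<in> fibrations" if "\<Phi> \<in> fibrations" "\<Psi> \<in> fibrations"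
  proof -
    have fib: "is_fibration \<phi>" "is_fibration \<psi>"
      using that \<phi> \<psi> by (simp_all add: cob_class_fibrations)
    note comp = Cob_comp_absorb_second[OF \<phi>(2) \<psi>(2) eq fib(2)]
    show ?thesis
      using is_fibration_absorb_second[OF \<psi>(2) fib eq] comp \<phi>(1) \<psi>(1) by (simp add: cob_class_fibrations)
  qed
next
  fix m n \<Phi> assume "\<Phi> \<in> Cob_hom m n"
  then obtain \<phi> :: "nat cob" where \<phi>: "\<Phi> = cob_class \<phi>" "is_cob \<phi>" "src \<phi> = m" "tgt \<phi> = n"
    by (rule Cob_homE)
  obtain e r :: "nat cob" where er: "is_cob e" "is_cob r" "src e = src \<phi>" "tgt e = src r" "tgt r = tgt \<phi>"
    "is_cofibration e" "is_fibration r" and eq: "cob_equiv (absorb_second e r) \<phi>"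
    using factorization_exists[OF \<phi>(2)] by blast
  note comp = Cob_comp_absorb_second[OF er(1,2,4,7)]
  have "\<Phi> = Cob_comp (cob_class r) (cob_class e)"
    unfolding \<phi>(1) comp(2) by (rule cob_class_eqI[OF comp(1) eq, symmetric])
  moreover have "cob_class e \<in> Cob_hom m (src r)" "cob_class r \<in> Cob_hom (src r) n"
    using Cob_hom_class[OF er(1)] Cob_hom_class[OF er(2)] er \<phi> by simp_all
  moreover have "cob_class e \<in> cofibrations" "cob_class r \<in> fibrations"
    using er by (simp_all add: cob_class_cofibrations cob_class_fibrations)
  ultimately show "\<exists>k\<in>UNIV. \<exists>E\<in>Cob_hom m k. \<exists>R\<in>Cob_hom k n.
      E \<in> cofibrations \<and> R \<in> fibrations \<and> \<Phi> = Cob_comp R E" by blast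
qed (rule Cob_orthogonality)

end
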